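(* Let $\mathcal{X}$ be a topological space, $\mathcal{U}$ an open cover of $\mathcal{X}$ with meet completion $\mathcal{M}(\mathcal{U})$ and lattice completion $\mathcal{L}(\mathcal{U})$, and let $i\colon\mathcal{M}(\mathcal{U})\hookrightarrow\mathrm{Open}(\mathcal{X})$ and $f\colon\mathcal{L}(\mathcal{U})\hookrightarrow\mathrm{Open}(\mathcal{X})$ be the inclusions. Let $T_\bullet$ be a superlinear family of translations on $\mathrm{Open}(\mathcal{X})$ and let $\delta>0$ be such that for every $V\in\mathrm{Open}(\mathcal{X})$ there exists $U\in\mathcal{L}(\mathcal{U})$ with $V\subseteq U\subseteq T_\delta(V)$. Then for any pair of cosheaves $M,N$ on $\mathcal{X}$ (valued in a cocomplete category $\mathbf{C}$), $$|d_{\mathcal{M}}(i^*M,i^*N)-d(M,N)|=|d_{\mathcal{L}}(f^*M,f^*N)-d(M,N)|\le2\delta,$$ where $d$ is the weak interleaving distance on $\mathrm{Open}(\mathcal{X})$-modules defined by $T_\bullet$, $d_{\mathcal{L}}$ is the weak interleaving distance on $\mathcal{L}(\mathcal{U})$-modules defined by the lower approximation translation $T^\flat_\bullet$, and $d_{\mathcal{M}}$ is the weak relative interleaving distance on $\mathcal{M}(\mathcal{U})$-modules with respect to the inclusion $j\colon\mathcal{M}(\mathcal{U})\hookrightarrow\mathcal{L}(\mathcal{U})$ and $T^\flat_\bullet$.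
   Context: Posets are viewed as categories; a $\mathcal{P}$-module is a functor $\mathcal{P}\to\mathbf{C}$. $\mathrm{Open}(\mathcal{X})$ is the poset of open sets ordered by inclusion. Covers: for an open cover $\mathcal{U}=\{U_k\}_{k\in\Lambda}$ of $\mathcal{X}$, $\mathcal{M}(\mathcal{U})\subseteq\mathrm{Open}(\mathcal{X})$ consists of all meets $\mathrm{int}(\bigcap_{k\in\sigma}U_k)$, $\sigma\subseteq\Lambda$ (the empty meet is $\mathcal{X}$), and $\mathcal{L}(\mathcal{U})\subseteq\mathrm{Open}(\mathcal{X})$ consists of all unions of elements of $\mathcal{M}(\mathcal{U})$ (including the empty union); both are ordered by inclusion. Cosheaves: a Čech cover of an open set $U$ is a collection of open sets with union $U$ such that every nonempty intersection of finitely many members is again a member. A functor $F\colon\mathrm{Open}(\mathcal{X})\to\mathbf{C}$ is a cosheaf if for every open $U$ and every Čech cover $\{U_i\}$ of $U$ (a subposet of $\mathrm{Open}(\mathcal{X})$), the canonical map $\varinjlim_iF(U_i)\to F(U)$ is an isomorphism. Pullback and pushforward: for a monotone map $g\colon\mathcal{P}\to\mathcal{Q}$, $g^*M=M\circ g$ and $(g_*M)(q)=\varinjlim_{p\,:\,g(p)\le q}M(p)$ (left Kan extension); $g_*$ is left adjoint to $g^*$, with unit $\upsilon$ and counit $\chi\colon g_*g^*\Rightarrow\mathrm{id}$. Translations: a translation on $\mathcal{Q}$ is a monotone $T\colon\mathcal{Q}\to\mathcal{Q}$ with $q\le T(q)$. A superlinear family is an assignment $\varepsilon\mapsto T_\varepsilon$,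 $\varepsilon\in[0,\infty)$, of translations with $T_{\varepsilon_2}\circ T_{\varepsilon_1}\le T_{\varepsilon_1+\varepsilon_2}$. With $f\colon\mathcal{L}(\mathcal{U})\hookrightarrow\mathrm{Open}(\mathcal{X})$ and $f_\flat(V)=\sup\{U\in\mathcal{L}(\mathcal{U})\mid U\subseteq V\}$, the lower approximation translation is $T^\flat_\varepsilon=f_\flat\circ T_\varepsilon\circ f$; it is a superlinear family of translations on $\mathcal{L}(\mathcal{U})$. Weak interleavings over a poset $\mathcal{Q}$ with superlinear family $T_\bullet$: $(M)^\varepsilon_{\mathcal{Q}}=M\circ T_\varepsilon$ (with $\varphi^\varepsilon=T_\varepsilon^*\varphi$). Internal maps of $M$ give natural maps $\eta^\varepsilon_{\mathcal{Q}}\colon M\to(M)^\varepsilon_{\mathcal{Q}}$, $\eta^{\varepsilon,\varepsilon'}_{\mathcal{Q}}\colon(M)^\varepsilon_{\mathcal{Q}}\to(M)^{\varepsilon'}_{\mathcal{Q}}$ ($\varepsilon\le\varepsilon'$), $\Sigma^{\varepsilon_1,\varepsilon_2}_{\mathcal{Q}}\colon((M)^{\varepsilon_1}_{\mathcal{Q}})^{\varepsilon_2}_{\mathcal{Q}}\to(M)^{\varepsilon_1+\varepsilon_2}_{\mathcal{Q}}$. A weak $\varepsilon$-interleaving of $M,N$ is a pair $\varphi\colon M\to(N)^\varepsilon_{\mathcal{Q}}$, $\psi\colon N\to(M)^\varepsilon_{\mathcal{Q}}$ with $\Sigma^{\varepsilon,\varepsilon}_{\mathcal{Q}}\circ\psi^\varepsilon\circ\varphi=\eta^{0,2\varepsilon}_{\mathcal{Q}}\circ\eta^0_{\mathcal{Q}}$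 on $M$ and symmetrically on $N$; the weak interleaving distance is the infimum of such $\varepsilon\ge0$ ($\infty$ if none). Weak interleavings relative to a monotone map $g\colon\mathcal{P}\to\mathcal{Q}$, with $\mathcal{Q}$ carrying a superlinear family $T_\bullet$: $(M)^\varepsilon_{\mathcal{P}}=g^*T_\varepsilon^*g_*M$ (with $\varphi^\varepsilon=g^*T_\varepsilon^*g_*\varphi$); $\eta^\varepsilon_{\mathcal{P}}$ is $M\xrightarrow{\upsilon}g^*g_*M\xrightarrow{g^*\eta^\varepsilon_{\mathcal{Q}}}(M)^\varepsilon_{\mathcal{P}}$; $\eta^{\varepsilon,\varepsilon'}_{\mathcal{P}}=g^*\eta^{\varepsilon,\varepsilon'}_{\mathcal{Q}}g_*$; $\Sigma^{\varepsilon_1,\varepsilon_2}_{\mathcal{P}}$ is the composite $g^*T_{\varepsilon_2}^*g_*g^*T_{\varepsilon_1}^*g_*M\xrightarrow{g^*T^*_{\varepsilon_2}\chi}g^*T_{\varepsilon_2}^*T_{\varepsilon_1}^*g_*M\xrightarrow{g^*\Sigma_{\mathcal{Q}}}g^*T_{\varepsilon_1+\varepsilon_2}^*g_*M$. A weak $\varepsilon$-interleaving relative to $g$ is a pair $\varphi\colon M\to(N)^\varepsilon_{\mathcal{P}}$, $\psi\colon N\to(M)^\varepsilon_{\mathcal{P}}$ satisfying the same two equations with subscript $\mathcal{P}$; the weak relative interleaving distance is the infimum of such $\varepsilon$ ($\infty$ if none). Distances take values in $[0,\infty]$; $|a-b|\le c$ means $a\le b+c$ and $b\le a+c$, and the displayed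 equality of differences expresses $d_{\mathcal{M}}(i^*M,i^*N)=d_{\mathcal{L}}(f^*M,f^*N)$. *)

theory Defs
  imports "HOL-Analysis.Analysis"
begin

section \<open>Categories, functors and colimits\<close>

record ('o, 'm) cat =
  Ob :: "'o set"
  Ar :: "'m set"
  src :: "'m \<Rightarrow> 'o"
  tgt :: "'m \<Rightarrow> 'o"
  idt :: "'o \<Rightarrow> 'm"
  cmp :: "'m \<Rightarrow> 'm \<Rightarrow> 'm"  \<comment> \<open>\<open>cmp C g f\<close> is \<open>g\<close> after \<open>f\<close>\<close>

definition hom_set :: "('o, 'm) cat \<Rightarrow> 'o \<Rightarrow> 'o \<Rightarrow> 'm set" where
  "hom_set C a b = {f \<in> Ar C. src C f = a \<and> tgt C f = b}"

definition is_category :: "('o, 'm) cat \<Rightarrow> bool" where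
  "is_category C \<longleftrightarrow>
     (\<forall>f\<in>Ar C. src C f \<in> Ob C \<and> tgt C f \<in> Ob C) \<and>
     (\<forall>a\<in>Ob C. idt C a \<in> hom_set C a a) \<and>
     (\<forall>f\<in>Ar C. \<forall>g\<in>Ar C. tgt C f = src C g \<longrightarrow> cmp C g f \<in> hom_set C (src C f) (tgt C g)) \<and>
     (\<forall>f\<in>Ar C. cmp C f (idt C (src C f)) = f \<and> cmp C (idt C (tgt C f)) f = f) \<and>
     (\<forall>f\<in>Ar C. \<forall>g\<in>Ar C. \<forall>h\<in>Ar C. tgt C f = src C g \<longrightarrow> tgt C g = src C h \<longrightarrow>
        cmp C h (cmp C g f) = cmp C (cmp C h g) f)"

definition is_iso :: "('o, 'm) cat \<Rightarrow> 'm \<Rightarrow> bool" where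
  "is_iso C f \<longleftrightarrow> f \<in> Ar C \<and>
     (\<exists>g\<in>hom_set C (tgt C f) (src C f).
        cmp C g f = idt C (src C f) \<and> cmp C f g = idt C (tgt C f))"

record ('i, 'j, 'o, 'm) cfunctor =
  fob :: "'i \<Rightarrow> 'o"
  far :: "'j \<Rightarrow> 'm"

definition is_functor :: "('i, 'j) cat \<Rightarrow> ('o, 'm) cat \<Rightarrow> ('i, 'j, 'o, 'm) cfunctor \<Rightarrow> bool" where
  "is_functor J C F \<longleftrightarrow>
     (\<forall>i\<in>Ob J. fob F i \<in> Ob C) \<and>
     (\<forall>u\<in>Ar J. far F u \<in> hom_set C (fob F (src J u)) (fob F (tgt J u))) \<and>
     (\<forall>i\<in>Ob J. far F (idt J i) = idt C (fob F i)) \<and>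
     (\<forall>u\<in>Ar J. \<forall>v\<in>Ar J. tgt J u = src J v \<longrightarrow>
        far F (cmp J v u) = cmp C (far F v) (far F u))"

definition is_nat_trans :: "('i, 'j) cat \<Rightarrow> ('o, 'm) cat \<Rightarrow>
    ('i, 'j, 'o, 'm) cfunctor \<Rightarrow> ('i, 'j, 'o, 'm) cfunctor \<Rightarrow> ('i \<Rightarrow> 'm) \<Rightarrow> bool" where
  "is_nat_trans J C F G \<phi> \<longleftrightarrow>
     (\<forall>i\<in>Ob J. \<phi> i \<in> hom_set C (fob F i) (fob G i)) \<and>
     (\<forall>u\<in>Ar J. cmp C (\<phi> (tgt J u)) (far F u) = cmp C (far G u) (\<phi> (src J u)))"

definition vcomp :: "('o, 'm) cat \<Rightarrow> ('i \<Rightarrow> 'm) \<Rightarrow> ('i \<Rightarrow> 'm) \<Rightarrow> 'i \<Rightarrow> 'm" where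
  "vcomp C \<psi> \<phi> = (\<lambda>i. cmp C (\<psi> i) (\<phi> i))"

definition is_cocone :: "('o, 'm) cat \<Rightarrow> ('i, 'j) cat \<Rightarrow> ('i, 'j, 'o, 'm) cfunctor \<Rightarrow>
    'o \<Rightarrow> ('i \<Rightarrow> 'm) \<Rightarrow> bool" where
  "is_cocone C J D L \<kappa> \<longleftrightarrow> L \<in> Ob C \<and>
     (\<forall>i\<in>Ob J. \<kappa> i \<in> hom_set C (fob D i) L) \<and>
     (\<forall>u\<in>Ar J. cmp C (\<kappa> (tgt J u)) (far D u) = \<kappa> (src J u))"

definition is_colimit :: "('o, 'm) cat \<Rightarrow> ('i, 'j) cat \<Rightarrow> ('i, 'j, 'o, 'm) cfunctor \<Rightarrow>
    'o \<Rightarrow> ('i \<Rightarrow> 'm) \<Rightarrow> bool" where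
  "is_colimit C J D L \<kappa> \<longleftrightarrow> is_cocone C J D L \<kappa> \<and>
     (\<forall>L' \<kappa>'. is_cocone C J D L' \<kappa>' \<longrightarrow>
        (\<exists>!h. h \<in> hom_set C L L' \<and> (\<forall>i\<in>Ob J. cmp C h (\<kappa> i) = \<kappa>' i)))"

text \<open>The type argument fixes the size of the small categories: those whose objects and arrows
  form subsets of \<open>'i\<close> and \<open>'j\<close>.\<close>

definition cocomplete :: "('i, 'j) cat itself \<Rightarrow> ('o, 'm) cat \<Rightarrow> bool" where
  "cocomplete _ C \<longleftrightarrow>
     (\<forall>(J :: ('i, 'j) cat) D. is_category J \<longrightarrow> is_functor J C D \<longrightarrow>
        (\<exists>L \<kappa>. is_colimit C J D L \<kappa>))"

text \<open>A chosen colimit, with its coprojections and the map out of it induced by a cocone.\<close>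

definition chosen_colim :: "('o, 'm) cat \<Rightarrow> ('i, 'j) cat \<Rightarrow> ('i, 'j, 'o, 'm) cfunctor \<Rightarrow>
    'o \<times> ('i \<Rightarrow> 'm)" where
  "chosen_colim C J D = (SOME (L, \<kappa>). is_colimit C J D L \<kappa>)"

definition colim :: "('o, 'm) cat \<Rightarrow> ('i, 'j) cat \<Rightarrow> ('i, 'j, 'o, 'm) cfunctor \<Rightarrow> 'o" where
  "colim C J D = fst (chosen_colim C J D)"

definition coproj :: "('o, 'm) cat \<Rightarrow> ('i, 'j) cat \<Rightarrow> ('i, 'j, 'o, 'm) cfunctor \<Rightarrow> 'i \<Rightarrow> 'm" where
  "coproj C J D = snd (chosen_colim C J D)"

definition colim_desc :: "('o, 'm) cat \<Rightarrow> ('i, 'j) cat \<Rightarrow> ('i, 'j, 'o, 'm) cfunctor \<Rightarrow>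
    'o \<Rightarrow> ('i \<Rightarrow> 'm) \<Rightarrow> 'm" where
  "colim_desc C J D L \<kappa> =
     (THE h. h \<in> hom_set C (colim C J D) L \<and> (\<forall>i\<in>Ob J. cmp C h (coproj C J D i) = \<kappa> i))"

section \<open>Modules over posets\<close>

definition poset_cat :: "'p::order set \<Rightarrow> ('p, 'p \<times> 'p) cat" where
  "poset_cat P = \<lparr>Ob = P, Ar = {(p, q). p \<in> P \<and> q \<in> P \<and> p \<le> q}, src = fst, tgt = snd,
     idt = (\<lambda>p. (p, p)), cmp = (\<lambda>v u. (fst u, snd v))\<rparr>"

type_synonym ('p, 'o, 'm) pmodule = "('p, 'p \<times> 'p, 'o, 'm) cfunctor"

abbreviation is_module :: "('o, 'm) cat \<Rightarrow> 'p::order set \<Rightarrow> ('p, 'o, 'm) pmodule \<Rightarrow> bool" where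
  "is_module C P M \<equiv> is_functor (poset_cat P) C M"

abbreviation is_module_map :: "('o, 'm) cat \<Rightarrow> 'p::order set \<Rightarrow> ('p, 'o, 'm) pmodule \<Rightarrow>
    ('p, 'o, 'm) pmodule \<Rightarrow> ('p \<Rightarrow> 'm) \<Rightarrow> bool" where
  "is_module_map C P M N \<phi> \<equiv> is_nat_trans (poset_cat P) C M N \<phi>"

text \<open>Pullback along a monotone map, on modules and on their maps.\<close>

definition pullback :: "('p \<Rightarrow> 'q) \<Rightarrow> ('q, 'o, 'm) pmodule \<Rightarrow> ('p, 'o, 'm) pmodule" where
  "pullback g M = \<lparr>fob = (\<lambda>p. fob M (g p)), far = (\<lambda>(p, p'). far M (g p, g p'))\<rparr>"

definition pullback_map :: "('p \<Rightarrow> 'q) \<Rightarrow> ('q \<Rightarrow> 'm) \<Rightarrow> 'p \<Rightarrow> 'm" where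
  "pullback_map g \<phi> = (\<lambda>p. \<phi> (g p))"

text \<open>Pushforward (left Kan extension) along \<open>g\<close> from the poset \<open>P\<close>, on modules and on their maps,
  and the unit and counit of its adjunction with the pullback.\<close>

definition below :: "'p::order set \<Rightarrow> ('p \<Rightarrow> 'q::order) \<Rightarrow> 'q \<Rightarrow> ('p, 'p \<times> 'p) cat" where
  "below P g q = poset_cat {p \<in> P. g p \<le> q}"

definition pushforward :: "('o, 'm) cat \<Rightarrow> 'p::order set \<Rightarrow> ('p \<Rightarrow> 'q::order) \<Rightarrow>
    ('p, 'o, 'm) pmodule \<Rightarrow> ('q, 'o, 'm) pmodule" where
  "pushforward C P g M =
     \<lparr>fob = (\<lambda>q. colim C (below P g q) M),
      far = (\<lambda>(q, q'). colim_desc C (below P g q) M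
               (colim C (below P g q') M) (coproj C (below P g q') M))\<rparr>"

definition pushforward_map :: "('o, 'm) cat \<Rightarrow> 'p::order set \<Rightarrow> ('p \<Rightarrow> 'q::order) \<Rightarrow>
    ('p, 'o, 'm) pmodule \<Rightarrow> ('p, 'o, 'm) pmodule \<Rightarrow> ('p \<Rightarrow> 'm) \<Rightarrow> 'q \<Rightarrow> 'm" where
  "pushforward_map C P g M N \<phi> = (\<lambda>q. colim_desc C (below P g q) M
     (colim C (below P g q) N) (vcomp C (coproj C (below P g q) N) \<phi>))"

definition adj_unit :: "('o, 'm) cat \<Rightarrow> 'p::order set \<Rightarrow> ('p \<Rightarrow> 'q::order) \<Rightarrow>
    ('p, 'o, 'm) pmodule \<Rightarrow> 'p \<Rightarrow> 'm" where
  "adj_unit C P g M = (\<lambda>p. coproj C (below P g (g p)) M p)"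

definition adj_counit :: "('o, 'm) cat \<Rightarrow> 'p::order set \<Rightarrow> ('p \<Rightarrow> 'q::order) \<Rightarrow>
    ('q, 'o, 'm) pmodule \<Rightarrow> 'q \<Rightarrow> 'm" where
  "adj_counit C P g N = (\<lambda>q. colim_desc C (below P g q) (pullback g N)
     (fob N q) (\<lambda>p. far N (g p, q)))"

section \<open>Weak interleavings\<close>

definition translation :: "'q::order set \<Rightarrow> ('q \<Rightarrow> 'q) \<Rightarrow> bool" where
  "translation Q t \<longleftrightarrow> t ` Q \<subseteq> Q \<and> mono_on Q t \<and> (\<forall>q\<in>Q. q \<le> t q)"

definition superlinear_family :: "'q::order set \<Rightarrow> (real \<Rightarrow> 'q \<Rightarrow> 'q) \<Rightarrow> bool" where
  "superlinear_family Q T \<longleftrightarrow>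
     (\<forall>\<epsilon>\<ge>0. translation Q (T \<epsilon>)) \<and>
     (\<forall>\<epsilon>\<^sub>1\<ge>0. \<forall>\<epsilon>\<^sub>2\<ge>0. \<forall>q\<in>Q. T \<epsilon>\<^sub>2 (T \<epsilon>\<^sub>1 q) \<le> T (\<epsilon>\<^sub>1 + \<epsilon>\<^sub>2) q)"

definition shift :: "(real \<Rightarrow> 'q \<Rightarrow> 'q) \<Rightarrow> real \<Rightarrow> ('q, 'o, 'm) pmodule \<Rightarrow> ('q, 'o, 'm) pmodule" where
  "shift T \<epsilon> M = pullback (T \<epsilon>) M"

definition shift_map :: "(real \<Rightarrow> 'q \<Rightarrow> 'q) \<Rightarrow> real \<Rightarrow> ('q \<Rightarrow> 'm) \<Rightarrow> 'q \<Rightarrow> 'm" where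
  "shift_map T \<epsilon> \<phi> = pullback_map (T \<epsilon>) \<phi>"

definition eta :: "(real \<Rightarrow> 'q \<Rightarrow> 'q) \<Rightarrow> real \<Rightarrow> ('q, 'o, 'm) pmodule \<Rightarrow> 'q \<Rightarrow> 'm" where
  "eta T \<epsilon> M = (\<lambda>q. far M (q, T \<epsilon> q))"

definition eta2 :: "(real \<Rightarrow> 'q \<Rightarrow> 'q) \<Rightarrow> real \<Rightarrow> real \<Rightarrow> ('q, 'o, 'm) pmodule \<Rightarrow> 'q \<Rightarrow> 'm" where
  "eta2 T \<epsilon> \<epsilon>' M = (\<lambda>q. far M (T \<epsilon> q, T \<epsilon>' q))"

definition Sig :: "(real \<Rightarrow> 'q \<Rightarrow> 'q) \<Rightarrow> real \<Rightarrow> real \<Rightarrow> ('q, 'o, 'm) pmodule \<Rightarrow> 'q \<Rightarrow> 'm" where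
  "Sig T \<epsilon>\<^sub>1 \<epsilon>\<^sub>2 M = (\<lambda>q. far M (T \<epsilon>\<^sub>1 (T \<epsilon>\<^sub>2 q), T (\<epsilon>\<^sub>1 + \<epsilon>\<^sub>2) q))"

definition weak_interleaving :: "('o, 'm) cat \<Rightarrow> 'q::order set \<Rightarrow> (real \<Rightarrow> 'q \<Rightarrow> 'q) \<Rightarrow> real \<Rightarrow>
    ('q, 'o, 'm) pmodule \<Rightarrow> ('q, 'o, 'm) pmodule \<Rightarrow> ('q \<Rightarrow> 'm) \<Rightarrow> ('q \<Rightarrow> 'm) \<Rightarrow> bool" where
  "weak_interleaving C Q T \<epsilon> M N \<phi> \<psi> \<longleftrightarrow>
     is_module_map C Q M (shift T \<epsilon> N) \<phi> \<and>
     is_module_map C Q N (shift T \<epsilon> M) \<psi> \<and>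
     (\<forall>q\<in>Q. vcomp C (Sig T \<epsilon> \<epsilon> M) (vcomp C (shift_map T \<epsilon> \<psi>) \<phi>) q =
             vcomp C (eta2 T 0 (2 * \<epsilon>) M) (eta T 0 M) q) \<and>
     (\<forall>q\<in>Q. vcomp C (Sig T \<epsilon> \<epsilon> N) (vcomp C (shift_map T \<epsilon> \<phi>) \<psi>) q =
             vcomp C (eta2 T 0 (2 * \<epsilon>) N) (eta T 0 N) q)"

definition weak_dist :: "('o, 'm) cat \<Rightarrow> 'q::order set \<Rightarrow> (real \<Rightarrow> 'q \<Rightarrow> 'q) \<Rightarrow>
    ('q, 'o, 'm) pmodule \<Rightarrow> ('q, 'o, 'm) pmodule \<Rightarrow> ennreal" where
  "weak_dist C Q T M N =
     Inf {ennreal \<epsilon> | \<epsilon>. \<epsilon> \<ge> 0 \<and> (\<exists>\<phi> \<psi>. weak_interleaving C Q T \<epsilon> M N \<phi> \<psi>)}"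

section \<open>Weak interleavings relative to a monotone map\<close>

text \<open>Here \<open>g\<close> is a monotone map from \<open>P\<close> to a poset \<open>Q\<close> on which \<open>T\<close> is a superlinear family;
  \<open>Q\<close> enters only through \<open>T\<close> and the pushforward.\<close>

definition rel_shift :: "('o, 'm) cat \<Rightarrow> 'p::order set \<Rightarrow> ('p \<Rightarrow> 'q::order) \<Rightarrow>
    (real \<Rightarrow> 'q \<Rightarrow> 'q) \<Rightarrow> real \<Rightarrow> ('p, 'o, 'm) pmodule \<Rightarrow> ('p, 'o, 'm) pmodule" where
  "rel_shift C P g T \<epsilon> M = pullback g (shift T \<epsilon> (pushforward C P g M))"

definition rel_shift_map :: "('o, 'm) cat \<Rightarrow> 'p::order set \<Rightarrow> ('p \<Rightarrow> 'q::order) \<Rightarrow>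
    (real \<Rightarrow> 'q \<Rightarrow> 'q) \<Rightarrow> real \<Rightarrow> ('p, 'o, 'm) pmodule \<Rightarrow> ('p, 'o, 'm) pmodule \<Rightarrow>
    ('p \<Rightarrow> 'm) \<Rightarrow> 'p \<Rightarrow> 'm" where
  "rel_shift_map C P g T \<epsilon> M N \<phi> =
     pullback_map g (shift_map T \<epsilon> (pushforward_map C P g M N \<phi>))"

definition rel_eta :: "('o, 'm) cat \<Rightarrow> 'p::order set \<Rightarrow> ('p \<Rightarrow> 'q::order) \<Rightarrow>
    (real \<Rightarrow> 'q \<Rightarrow> 'q) \<Rightarrow> real \<Rightarrow> ('p, 'o, 'm) pmodule \<Rightarrow> 'p \<Rightarrow> 'm" where
  "rel_eta C P g T \<epsilon> M =
     vcomp C (pullback_map g (eta T \<epsilon> (pushforward C P g M))) (adj_unit C P g M)"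

definition rel_eta2 :: "('o, 'm) cat \<Rightarrow> 'p::order set \<Rightarrow> ('p \<Rightarrow> 'q::order) \<Rightarrow>
    (real \<Rightarrow> 'q \<Rightarrow> 'q) \<Rightarrow> real \<Rightarrow> real \<Rightarrow> ('p, 'o, 'm) pmodule \<Rightarrow> 'p \<Rightarrow> 'm" where
  "rel_eta2 C P g T \<epsilon> \<epsilon>' M = pullback_map g (eta2 T \<epsilon> \<epsilon>' (pushforward C P g M))"

definition rel_Sig :: "('o, 'm) cat \<Rightarrow> 'p::order set \<Rightarrow> ('p \<Rightarrow> 'q::order) \<Rightarrow>
    (real \<Rightarrow> 'q \<Rightarrow> 'q) \<Rightarrow> real \<Rightarrow> real \<Rightarrow> ('p, 'o, 'm) pmodule \<Rightarrow> 'p \<Rightarrow> 'm" where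
  "rel_Sig C P g T \<epsilon>\<^sub>1 \<epsilon>\<^sub>2 M =
     vcomp C (pullback_map g (Sig T \<epsilon>\<^sub>1 \<epsilon>\<^sub>2 (pushforward C P g M)))
       (pullback_map g (shift_map T \<epsilon>\<^sub>2 (adj_counit C P g (shift T \<epsilon>\<^sub>1 (pushforward C P g M)))))"

definition weak_rel_interleaving :: "('o, 'm) cat \<Rightarrow> 'p::order set \<Rightarrow> ('p \<Rightarrow> 'q::order) \<Rightarrow>
    (real \<Rightarrow> 'q \<Rightarrow> 'q) \<Rightarrow> real \<Rightarrow> ('p, 'o, 'm) pmodule \<Rightarrow> ('p, 'o, 'm) pmodule \<Rightarrow>
    ('p \<Rightarrow> 'm) \<Rightarrow> ('p \<Rightarrow> 'm) \<Rightarrow> bool" where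
  "weak_rel_interleaving C P g T \<epsilon> M N \<phi> \<psi> \<longleftrightarrow>
     is_module_map C P M (rel_shift C P g T \<epsilon> N) \<phi> \<and>
     is_module_map C P N (rel_shift C P g T \<epsilon> M) \<psi> \<and>
     (\<forall>p\<in>P. vcomp C (rel_Sig C P g T \<epsilon> \<epsilon> M)
               (vcomp C (rel_shift_map C P g T \<epsilon> N (rel_shift C P g T \<epsilon> M) \<psi>) \<phi>) p =
             vcomp C (rel_eta2 C P g T 0 (2 * \<epsilon>) M) (rel_eta C P g T 0 M) p) \<and>
     (\<forall>p\<in>P. vcomp C (rel_Sig C P g T \<epsilon> \<epsilon> N)
               (vcomp C (rel_shift_map C P g T \<epsilon> M (rel_shift C P g T \<epsilon> N) \<phi>) \<psi>) p =
             vcomp C (rel_eta2 C P g T 0 (2 * \<epsilon>) N) (rel_eta C P g T 0 N) p)"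

definition weak_rel_dist :: "('o, 'm) cat \<Rightarrow> 'p::order set \<Rightarrow> ('p \<Rightarrow> 'q::order) \<Rightarrow>
    (real \<Rightarrow> 'q \<Rightarrow> 'q) \<Rightarrow> ('p, 'o, 'm) pmodule \<Rightarrow> ('p, 'o, 'm) pmodule \<Rightarrow> ennreal" where
  "weak_rel_dist C P g T M N =
     Inf {ennreal \<epsilon> | \<epsilon>. \<epsilon> \<ge> 0 \<and> (\<exists>\<phi> \<psi>. weak_rel_interleaving C P g T \<epsilon> M N \<phi> \<psi>)}"

section \<open>Open covers and cosheaves\<close>

definition opens :: "'a topology \<Rightarrow> 'a set set" where
  "opens X = {V. openin X V}"

definition open_cover :: "'a topology \<Rightarrow> 'k set \<Rightarrow> ('k \<Rightarrow> 'a set) \<Rightarrow> bool" where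
  "open_cover X \<Lambda> U \<longleftrightarrow> (\<forall>k\<in>\<Lambda>. openin X (U k)) \<and> (\<Union>k\<in>\<Lambda>. U k) = topspace X"

text \<open>Intersecting with \<open>topspace X\<close> makes the empty meet the whole space.\<close>

definition meet_completion :: "'a topology \<Rightarrow> 'k set \<Rightarrow> ('k \<Rightarrow> 'a set) \<Rightarrow> 'a set set" where
  "meet_completion X \<Lambda> U =
     {X interior_of (topspace X \<inter> (\<Inter>k\<in>\<sigma>. U k)) | \<sigma>. \<sigma> \<subseteq> \<Lambda>}"

definition lattice_completion :: "'a topology \<Rightarrow> 'k set \<Rightarrow> ('k \<Rightarrow> 'a set) \<Rightarrow> 'a set set" where
  "lattice_completion X \<Lambda> U = {\<Union>\<S> | \<S>. \<S> \<subseteq> meet_completion X \<Lambda> U}"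

text \<open>For a family \<open>L\<close> closed under unions, the supremum defining the lower approximation is a
  union, taken in \<open>L\<close> or among all open sets.\<close>

definition lower_approx :: "'a set set \<Rightarrow> 'a set \<Rightarrow> 'a set" where
  "lower_approx L V = \<Union>{U \<in> L. U \<subseteq> V}"

definition lower_translation :: "'a set set \<Rightarrow> (real \<Rightarrow> 'a set \<Rightarrow> 'a set) \<Rightarrow>
    real \<Rightarrow> 'a set \<Rightarrow> 'a set" where
  "lower_translation L T \<epsilon> U = lower_approx L (T \<epsilon> U)"

definition cech_cover :: "'a topology \<Rightarrow> 'a set \<Rightarrow> 'a set set \<Rightarrow> bool" where
  "cech_cover X V \<V> \<longleftrightarrow> \<V> \<subseteq> opens X \<and> \<Union>\<V> = V \<and>
     (\<forall>\<F>. \<F> \<subseteq> \<V> \<longrightarrow> finite \<F> \<longrightarrow> \<F> \<noteq> {} \<longrightarrow> \<Inter>\<F> \<noteq> {} \<longrightarrow> \<Inter>\<F> \<in> \<V>)"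

definition cosheaf :: "('o, 'm) cat \<Rightarrow> 'a topology \<Rightarrow> ('a set, 'o, 'm) pmodule \<Rightarrow> bool" where
  "cosheaf C X F \<longleftrightarrow> is_module C (opens X) F \<and>
     (\<forall>V\<in>opens X. \<forall>\<V>. cech_cover X V \<V> \<longrightarrow>
        is_iso C (colim_desc C (poset_cat \<V>) F (fob F V) (\<lambda>W. far F (W, V))))"

end

theory Submission
  imports Defs
begin

text \<open>The distance over the meet completion equals the one over the lattice completion for two reasons.
  For any monotone \<open>g\<close>, adjunction turns maps \<open>A \<rightarrow> g\<^sup>* T\<^sub>\<epsilon>\<^sup>* g\<^sub>* B\<close> into maps \<open>g\<^sub>* A \<rightarrow> T\<^sub>\<epsilon>\<^sup>* g\<^sub>* B\<close>, and it turns
  the equations of a relative interleaving into those of an interleaving, because both sides are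
  natural maps out of \<open>g\<^sub>* A\<close> and such maps are determined by their composites with the unit. So the
  relative distance of \<open>A\<close> and \<open>B\<close> is always the distance of \<open>g\<^sub>* A\<close> and \<open>g\<^sub>* B\<close>
  (\<open>weak_rel_dist_eq_pushforward\<close>). For the inclusion of the meet completion and the restriction of a
  cosheaf \<open>M\<close>, the value of the pushforward at a member \<open>V\<close> of the lattice completion is the colimit of
  \<open>M\<close> over the meets inside \<open>V\<close>. These form a Cech cover of \<open>V\<close>, so the counit is invertible
  (\<open>cosheaf_counit_iso\<close>), and distances do not change along isomorphisms (\<open>weak_dist_iso\<close>).

  The comparison with the distance on all open sets comes from a comparison of translations
  (\<open>weak_dist_approximation\<close>). Density of the lattice completion gives
  \<open>T\<^sub>\<epsilon> V \<subseteq> T\<^sup>\<flat>\<^sub>\<epsilon>\<^sub>+\<^sub>\<delta> V \<subseteq> T\<^sub>\<epsilon>\<^sub>+\<^sub>\<delta> V\<close> for every open \<open>V\<close>. An \<open>\<epsilon>\<close>-interleaving on open sets therefore restricts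
  to an \<open>(\<epsilon> + \<delta>)\<close>-interleaving on the lattice completion after composing with internal maps. An
  \<open>\<epsilon>\<close>-interleaving on the lattice completion extends to an \<open>(\<epsilon> + \<delta>)\<close>-interleaving on open sets by first
  enlarging \<open>V\<close> to \<open>T\<^sup>\<flat>\<^sub>\<delta> V\<close>, which lies in the lattice completion. This bounds both differences by
  \<open>\<delta>\<close>, hence by \<open>2 * \<delta>\<close>.\<close>

section \<open>Calculus in a category\<close>

locale category =
  fixes C :: "('o, 'm) cat"
  assumes is_category: "is_category C"
begin

abbreviation compose :: "'m \<Rightarrow> 'm \<Rightarrow> 'm" (infixr "\<cdot>" 70) where
  "g \<cdot> f \<equiv> cmp C g f"

abbreviation hom :: "'o \<Rightarrow> 'o \<Rightarrow> 'm set" where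
  "hom \<equiv> hom_set C"

lemma comp_hom: "f \<in> hom a b \<Longrightarrow> g \<in> hom b c \<Longrightarrow> g \<cdot> f \<in> hom a c"
  using is_category unfolding is_category_def hom_set_def by fastforce

lemma comp_assoc:
  "f \<in> hom a b \<Longrightarrow> g \<in> hom b c \<Longrightarrow> h \<in> hom c d \<Longrightarrow> (h \<cdot> g) \<cdot> f = h \<cdot> g \<cdot> f"
  using is_category unfolding is_category_def hom_set_def by fastforce

lemma comp_id_right: "f \<in> hom a b \<Longrightarrow> f \<cdot> idt C a = f"
  using is_category unfolding is_category_def hom_set_def by fastforce

lemma comp_id_left: "f \<in> hom a b \<Longrightarrow> idt C b \<cdot> f = f"
  using is_category unfolding is_category_def hom_set_def by fastforce

text \<open>These conditional rules let the simplifier rebracket a composite once the types of its factors are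
  given.\<close>

lemma comp_arrow [simp]:
  assumes "f \<in> Ar C" "g \<in> Ar C" "tgt C f = src C g"
  shows "g \<cdot> f \<in> Ar C" "src C (g \<cdot> f) = src C f" "tgt C (g \<cdot> f) = tgt C g"
  using comp_hom[of f "src C f" "tgt C f" g "tgt C g"] assms by (simp_all add: hom_set_def)

lemma comp_assoc_arrow [simp]:
  "f \<in> Ar C \<Longrightarrow> g \<in> Ar C \<Longrightarrow> h \<in> Ar C \<Longrightarrow> tgt C f = src C g \<Longrightarrow> tgt C g = src C h \<Longrightarrow>
     (h \<cdot> g) \<cdot> f = h \<cdot> g \<cdot> f"
  by (rule comp_assoc) (auto simp: hom_set_def)

lemma comp_id_arrow [simp]:
  "f \<in> Ar C \<Longrightarrow> src C f = a \<Longrightarrow> f \<cdot> idt C a = f"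
  "f \<in> Ar C \<Longrightarrow> tgt C f = b \<Longrightarrow> idt C b \<cdot> f = f"
  by (auto intro!: comp_id_left comp_id_right simp: hom_set_def)

lemma hom_ob: "f \<in> hom a b \<Longrightarrow> a \<in> Ob C \<and> b \<in> Ob C"
  using is_category unfolding is_category_def hom_set_def by fastforce

lemma is_isoE:
  assumes "is_iso C f" "f \<in> hom a b"
  obtains g where "g \<in> hom b a" "g \<cdot> f = idt C a" "f \<cdot> g = idt C b"
  using assms unfolding is_iso_def hom_set_def by auto

end

section \<open>Modules over posets\<close>

lemma is_category_poset_cat: "is_category (poset_cat P)"
  unfolding is_category_def poset_cat_def hom_set_def by (auto intro: order_trans)

lemma is_module_iff:
  "is_module C P M \<longleftrightarrow>
     (\<forall>p\<in>P. fob M p \<in> Ob C) \<and>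
     (\<forall>p\<in>P. \<forall>q\<in>P. p \<le> q \<longrightarrow> far M (p, q) \<in> hom_set C (fob M p) (fob M q)) \<and>
     (\<forall>p\<in>P. far M (p, p) = idt C (fob M p)) \<and>
     (\<forall>p\<in>P. \<forall>q\<in>P. \<forall>r\<in>P. p \<le> q \<longrightarrow> q \<le> r \<longrightarrow> far M (p, r) = cmp C (far M (q, r)) (far M (p, q)))"
proof -
  have pairs: "(\<forall>u\<in>{(p, q). p \<in> P \<and> q \<in> P \<and> p \<le> q}. R u) \<longleftrightarrow>
      (\<forall>p\<in>P. \<forall>q\<in>P. p \<le> q \<longrightarrow> R (p, q))" for R
    by auto
  show ?thesis
    unfolding is_functor_def poset_cat_def by (simp add: pairs) (simp add: Ball_def imp_conjL)
qed

lemma is_module_map_iff: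
  "is_module_map C P M N \<phi> \<longleftrightarrow>
     (\<forall>p\<in>P. \<phi> p \<in> hom_set C (fob M p) (fob N p)) \<and>
     (\<forall>p\<in>P. \<forall>q\<in>P. p \<le> q \<longrightarrow> cmp C (\<phi> q) (far M (p, q)) = cmp C (far N (p, q)) (\<phi> p))"
  unfolding is_nat_trans_def poset_cat_def by auto

lemma module_ob: "is_module C P M \<Longrightarrow> p \<in> P \<Longrightarrow> fob M p \<in> Ob C"
  by (simp add: is_module_iff)

lemma module_hom:
  "is_module C P M \<Longrightarrow> p \<in> P \<Longrightarrow> q \<in> P \<Longrightarrow> p \<le> q \<Longrightarrow> far M (p, q) \<in> hom_set C (fob M p) (fob M q)"
  unfolding is_module_iff by blast

lemma module_id: "is_module C P M \<Longrightarrow> p \<in> P \<Longrightarrow> far M (p, p) = idt C (fob M p)"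
  unfolding is_module_iff by blast

lemma module_comp:
  "is_module C P M \<Longrightarrow> p \<in> P \<Longrightarrow> q \<in> P \<Longrightarrow> r \<in> P \<Longrightarrow> p \<le> q \<Longrightarrow> q \<le> r \<Longrightarrow>
     cmp C (far M (q, r)) (far M (p, q)) = far M (p, r)"
  unfolding is_module_iff by metis

lemma module_map_hom:
  "is_module_map C P M N \<phi> \<Longrightarrow> p \<in> P \<Longrightarrow> \<phi> p \<in> hom_set C (fob M p) (fob N p)"
  unfolding is_module_map_iff by blast

lemma module_map_natural:
  "is_module_map C P M N \<phi> \<Longrightarrow> p \<in> P \<Longrightarrow> q \<in> P \<Longrightarrow> p \<le> q \<Longrightarrow>
     cmp C (\<phi> q) (far M (p, q)) = cmp C (far N (p, q)) (\<phi> p)"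
  unfolding is_module_map_iff by blast

lemma is_module_subset: "is_module C Q M \<Longrightarrow> P \<subseteq> Q \<Longrightarrow> is_module C P M"
  unfolding is_module_iff by (meson subsetD)

lemma pullback_simps [simp]:
  "fob (pullback g M) p = fob M (g p)"
  "far (pullback g M) (p, q) = far M (g p, g q)"
  by (simp_all add: pullback_def)

lemma pullback_id [simp]: "pullback id M = M"
  by (simp add: pullback_def)

lemma shift_simps [simp]:
  "fob (shift T \<epsilon> M) p = fob M (T \<epsilon> p)"
  "far (shift T \<epsilon> M) (p, q) = far M (T \<epsilon> p, T \<epsilon> q)"
  by (simp_all add: shift_def)

lemma is_module_pullback:
  "is_module C Q M \<Longrightarrow> g ` P \<subseteq> Q \<Longrightarrow> mono_on P g \<Longrightarrow> is_module C P (pullback g M)"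
  unfolding is_module_iff pullback_simps by (simp add: image_subset_iff mono_on_def)

lemma module_map_pullback:
  "is_module_map C Q M N \<phi> \<Longrightarrow> g ` P \<subseteq> Q \<Longrightarrow> mono_on P g \<Longrightarrow>
     is_module_map C P (pullback g M) (pullback g N) (\<lambda>p. \<phi> (g p))"
  unfolding is_module_map_iff pullback_simps by (simp add: image_subset_iff mono_on_def)

lemma (in category) module_map_comp:
  assumes A: "is_module C P A" and B: "is_module C P B" and D: "is_module C P D"
    and \<phi>: "is_module_map C P A B \<phi>" and \<psi>: "is_module_map C P B D \<psi>"
  shows "is_module_map C P A D (\<lambda>p. \<psi> p \<cdot> \<phi> p)"
  unfolding is_module_map_iff
proof (intro conjI ballI impI)
  show "\<psi> p \<cdot> \<phi> p \<in> hom (fob A p) (fob D p)" if "p \<in> P" for p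
    using module_map_hom[OF \<phi> that] module_map_hom[OF \<psi> that] by (rule comp_hom)
  fix p q assume pq: "p \<in> P" "q \<in> P" "p \<le> q"
  note t = module_map_hom[OF \<phi> pq(1)] module_map_hom[OF \<phi> pq(2)] module_map_hom[OF \<psi> pq(1)]
    module_map_hom[OF \<psi> pq(2)] module_hom[OF A pq] module_hom[OF B pq] module_hom[OF D pq]
  have "(\<psi> q \<cdot> \<phi> q) \<cdot> far A (p, q) = \<psi> q \<cdot> (\<phi> q \<cdot> far A (p, q))"
    using t by (simp add: hom_set_def)
  also have "\<dots> = (\<psi> q \<cdot> far B (p, q)) \<cdot> \<phi> p"
    using t by (simp only: module_map_natural[OF \<phi> pq]) (simp add: hom_set_def)
  also have "\<dots> = far D (p, q) \<cdot> \<psi> p \<cdot> \<phi> p"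
    using t by (simp only: module_map_natural[OF \<psi> pq]) (simp add: hom_set_def)
  finally show "(\<psi> q \<cdot> \<phi> q) \<cdot> far A (p, q) = far D (p, q) \<cdot> \<psi> p \<cdot> \<phi> p" .
qed

text \<open>Internal maps are natural because every square of internal maps commutes.\<close>

lemma module_map_internal:
  assumes M: "is_module C Q M" and f: "f ` P \<subseteq> Q" "mono_on P f" and g: "g ` P \<subseteq> Q" "mono_on P g"
    and le: "\<And>p. p \<in> P \<Longrightarrow> f p \<le> g p"
  shows "is_module_map C P (pullback f M) (pullback g M) (\<lambda>p. far M (f p, g p))"
  unfolding is_module_map_iff pullback_simps
proof (intro conjI ballI impI)
  show "far M (f p, g p) \<in> hom_set C (fob M (f p)) (fob M (g p))" if "p \<in> P" for p
    using M f g le that by (intro module_hom) auto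
  fix p q assume pq: "p \<in> P" "q \<in> P" "p \<le> q"
  have "cmp C (far M (f q, g q)) (far M (f p, f q)) = far M (f p, g q)"
    using M f g le pq by (intro module_comp) (auto dest: mono_onD)
  moreover have "cmp C (far M (g p, g q)) (far M (f p, g p)) = far M (f p, g q)"
    using M f g le pq by (intro module_comp) (auto dest: mono_onD)
  ultimately show "cmp C (far M (f q, g q)) (far M (f p, f q)) =
      cmp C (far M (g p, g q)) (far M (f p, g p))" by simp
qed

section \<open>Superlinear families\<close>

locale superlinear =
  fixes Q :: "'q::order set" and T :: "real \<Rightarrow> 'q \<Rightarrow> 'q"
  assumes superlinear_family: "superlinear_family Q T"
begin

lemma translation_T: "\<epsilon> \<ge> 0 \<Longrightarrow> translation Q (T \<epsilon>)"
  using superlinear_family by (simp add: superlinear_family_def)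

lemma T_in: "\<epsilon> \<ge> 0 \<Longrightarrow> q \<in> Q \<Longrightarrow> T \<epsilon> q \<in> Q"
  using translation_T[of \<epsilon>] by (simp add: translation_def image_subset_iff)

lemma T_mono: "\<epsilon> \<ge> 0 \<Longrightarrow> p \<in> Q \<Longrightarrow> q \<in> Q \<Longrightarrow> p \<le> q \<Longrightarrow> T \<epsilon> p \<le> T \<epsilon> q"
  using translation_T[of \<epsilon>] by (simp add: translation_def mono_on_def)

lemma T_ge: "\<epsilon> \<ge> 0 \<Longrightarrow> q \<in> Q \<Longrightarrow> q \<le> T \<epsilon> q"
  using translation_T[of \<epsilon>] by (simp add: translation_def)

lemma T_image: "\<epsilon> \<ge> 0 \<Longrightarrow> T \<epsilon> ` Q \<subseteq> Q"
  using translation_T[of \<epsilon>] by (simp add: translation_def)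

lemma mono_on_T: "\<epsilon> \<ge> 0 \<Longrightarrow> mono_on Q (T \<epsilon>)"
  using translation_T[of \<epsilon>] by (simp add: translation_def)

lemma T_T_le: "\<epsilon>\<^sub>1 \<ge> 0 \<Longrightarrow> \<epsilon>\<^sub>2 \<ge> 0 \<Longrightarrow> q \<in> Q \<Longrightarrow> T \<epsilon>\<^sub>2 (T \<epsilon>\<^sub>1 q) \<le> T (\<epsilon>\<^sub>1 + \<epsilon>\<^sub>2) q"
  using superlinear_family by (simp add: superlinear_family_def)

lemma T_mono_param:
  assumes "0 \<le> \<epsilon>" "\<epsilon> \<le> \<epsilon>'" "q \<in> Q"
  shows "T \<epsilon> q \<le> T \<epsilon>' q"
proof -
  have "T \<epsilon> q \<le> T (\<epsilon>' - \<epsilon>) (T \<epsilon> q)" using assms by (intro T_ge T_in) auto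
  also have "\<dots> \<le> T (\<epsilon> + (\<epsilon>' - \<epsilon>)) q" using assms by (intro T_T_le) auto
  finally show ?thesis by simp
qed

lemma T_T_le_double: "\<epsilon> \<ge> 0 \<Longrightarrow> q \<in> Q \<Longrightarrow> T \<epsilon> (T \<epsilon> q) \<le> T (2 * \<epsilon>) q"
  using T_T_le[of \<epsilon> \<epsilon> q] by (simp only: mult_2)

lemma is_module_shift: "is_module C Q M \<Longrightarrow> \<epsilon> \<ge> 0 \<Longrightarrow> is_module C Q (shift T \<epsilon> M)"
  unfolding shift_def by (rule is_module_pullback[OF _ T_image mono_on_T])

lemma module_map_shift:
  "is_module_map C Q M N \<phi> \<Longrightarrow> \<epsilon> \<ge> 0 \<Longrightarrow>
     is_module_map C Q (shift T \<epsilon> M) (shift T \<epsilon> N) (\<lambda>q. \<phi> (T \<epsilon> q))"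
  unfolding shift_def by (rule module_map_pullback[OF _ T_image mono_on_T])

end

section \<open>Interleavings and their invariance under isomorphism\<close>

text \<open>One of the two equations of a weak interleaving, with the internal maps on its right-hand side
  composed. The other one exchanges the modules and the maps, so that statements about this
  equation are used twice.\<close>

definition interleaving_triangle ::
    "('o, 'm) cat \<Rightarrow> 'q::order set \<Rightarrow> (real \<Rightarrow> 'q \<Rightarrow> 'q) \<Rightarrow> real \<Rightarrow> ('q, 'o, 'm) pmodule \<Rightarrow>
      ('q \<Rightarrow> 'm) \<Rightarrow> ('q \<Rightarrow> 'm) \<Rightarrow> bool" where
  "interleaving_triangle C Q T \<epsilon> M \<phi> \<psi> \<longleftrightarrow>
     (\<forall>q\<in>Q. cmp C (far M (T \<epsilon> (T \<epsilon> q), T (2 * \<epsilon>) q)) (cmp C (\<psi> (T \<epsilon> q)) (\<phi> q)) =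
            far M (q, T (2 * \<epsilon>) q))"

text \<open>The translation \<open>T 0\<close> need not be the identity, but the internal maps through it compose.\<close>

lemma (in superlinear) weak_interleaving_iff:
  assumes M: "is_module C Q M" and N: "is_module C Q N" and \<epsilon>: "\<epsilon> \<ge> 0"
  shows "weak_interleaving C Q T \<epsilon> M N \<phi> \<psi> \<longleftrightarrow>
    is_module_map C Q M (shift T \<epsilon> N) \<phi> \<and> is_module_map C Q N (shift T \<epsilon> M) \<psi> \<and>
    interleaving_triangle C Q T \<epsilon> M \<phi> \<psi> \<and> interleaving_triangle C Q T \<epsilon> N \<psi> \<phi>"
proof -
  have internal: "vcomp C (eta2 T 0 (2 * \<epsilon>) L) (eta T 0 L) q = far L (q, T (2 * \<epsilon>) q)"
    if "is_module C Q L" "q \<in> Q" for L q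
    using that \<epsilon> unfolding vcomp_def eta2_def eta_def
    by (intro module_comp) (auto simp: T_in T_ge intro: T_mono_param)
  show ?thesis
    unfolding weak_interleaving_def interleaving_triangle_def
    using internal[OF M] internal[OF N]
    by (simp add: vcomp_def Sig_def shift_map_def pullback_map_def)
qed

text \<open>An isomorphism of modules together with its inverse, which is kept as a parameter so that the two
  directions can be exchanged.\<close>

locale module_iso = category C for C :: "('o, 'm) cat" +
  fixes Q :: "'q::order set" and M M' :: "('q, 'o, 'm) pmodule" and \<alpha> \<alpha>' :: "'q \<Rightarrow> 'm"
  assumes M: "is_module C Q M" and M': "is_module C Q M'"
    and \<alpha>: "is_module_map C Q M M' \<alpha>"
    and \<alpha>': "\<And>q. q \<in> Q \<Longrightarrow> \<alpha>' q \<in> hom (fob M' q) (fob M q)"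
    and \<alpha>'\<alpha>: "\<And>q. q \<in> Q \<Longrightarrow> \<alpha>' q \<cdot> \<alpha> q = idt C (fob M q)"
    and \<alpha>\<alpha>': "\<And>q. q \<in> Q \<Longrightarrow> \<alpha> q \<cdot> \<alpha>' q = idt C (fob M' q)"
begin

lemma inverse_natural:
  assumes "p \<in> Q" "q \<in> Q" "p \<le> q"
  shows "\<alpha>' q \<cdot> far M' (p, q) = far M (p, q) \<cdot> \<alpha>' p"
proof -
  note t = module_map_hom[OF \<alpha> assms(1)] module_map_hom[OF \<alpha> assms(2)] \<alpha>'[OF assms(1)]
    \<alpha>'[OF assms(2)] module_hom[OF M assms] module_hom[OF M' assms]
  have "\<alpha>' q \<cdot> far M' (p, q) = \<alpha>' q \<cdot> far M' (p, q) \<cdot> (\<alpha> p \<cdot> \<alpha>' p)"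
    using t by (simp only: \<alpha>\<alpha>'[OF assms(1)]) (simp add: hom_set_def)
  also have "\<dots> = \<alpha>' q \<cdot> (far M' (p, q) \<cdot> \<alpha> p) \<cdot> \<alpha>' p"
    using t by (simp add: hom_set_def)
  also have "\<dots> = \<alpha>' q \<cdot> (\<alpha> q \<cdot> far M (p, q)) \<cdot> \<alpha>' p"
    by (simp only: module_map_natural[OF \<alpha> assms])
  also have "\<dots> = (\<alpha>' q \<cdot> \<alpha> q) \<cdot> far M (p, q) \<cdot> \<alpha>' p"
    using t by (simp add: hom_set_def)
  also have "\<dots> = far M (p, q) \<cdot> \<alpha>' p"
    using t by (simp only: \<alpha>'\<alpha>[OF assms(2)]) (simp add: hom_set_def)
  finally show ?thesis .
qed

lemma inverse_module_map: "is_module_map C Q M' M \<alpha>'"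
  unfolding is_module_map_iff using \<alpha>' inverse_natural by blast

lemma flip: "module_iso C Q M' M \<alpha>' \<alpha>"
  using inverse_module_map \<alpha>' \<alpha>'\<alpha> \<alpha>\<alpha>' module_map_hom[OF \<alpha>] M M'
  by unfold_locales (auto simp: is_module_map_iff)

end

text \<open>Interleaving maps are transported by conjugation. In a triangle of conjugates the inner
  isomorphism cancels, and the outer ones cancel after moving past the internal maps.\<close>

locale interleaving_transport =
  superlinear Q T + m: module_iso C Q M M' \<alpha> \<alpha>' + n: module_iso C Q N N' \<beta> \<beta>'
  for Q :: "'q::order set" and T and C :: "('o, 'm) cat"
    and M M' :: "('q, 'o, 'm) pmodule" and \<alpha> \<alpha>' and N N' :: "('q, 'o, 'm) pmodule" and \<beta> \<beta>'
begin

lemma conjugate_module_map: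
  assumes \<epsilon>: "\<epsilon> \<ge> 0" and \<phi>: "is_module_map C Q M (shift T \<epsilon> N) \<phi>"
  shows "is_module_map C Q M' (shift T \<epsilon> N')
    (\<lambda>q. \<beta> (T \<epsilon> q) \<cdot> \<phi> q \<cdot> \<alpha>' q)"
  using m.inverse_module_map \<phi> module_map_shift[OF n.\<alpha> \<epsilon>] m.M m.M'
    is_module_shift[OF n.M \<epsilon>] is_module_shift[OF n.M' \<epsilon>]
  by (intro m.module_map_comp[of Q M' "shift T \<epsilon> N" "shift T \<epsilon> N'"] m.module_map_comp[of Q M' M])

lemma conjugate_triangle:
  assumes \<epsilon>: "\<epsilon> \<ge> 0" and \<phi>: "is_module_map C Q M (shift T \<epsilon> N) \<phi>"
    and \<psi>: "is_module_map C Q N (shift T \<epsilon> M) \<psi>"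
    and triangle: "interleaving_triangle C Q T \<epsilon> M \<phi> \<psi>"
  shows "interleaving_triangle C Q T \<epsilon> M'
    (\<lambda>q. \<beta> (T \<epsilon> q) \<cdot> \<phi> q \<cdot> \<alpha>' q)
    (\<lambda>q. \<alpha> (T \<epsilon> q) \<cdot> \<psi> q \<cdot> \<beta>' q)"
  unfolding interleaving_triangle_def
proof
  fix q assume q: "q \<in> Q"
  define r s t where "r = T \<epsilon> q" and "s = T \<epsilon> r" and "t = T (2 * \<epsilon>) q"
  have Q: "r \<in> Q" "s \<in> Q" "t \<in> Q" and le: "s \<le> t" "q \<le> t"
    using q \<epsilon> by (auto simp: r_def s_def t_def T_in T_ge T_T_le_double)
  have \<phi>h: "\<phi> q \<in> hom_set C (fob M q) (fob N r)" and \<psi>h: "\<psi> r \<in> hom_set C (fob N r) (fob M s)"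
    using module_map_hom[OF \<phi> q] module_map_hom[OF \<psi> Q(1)] by (simp_all add: r_def s_def)
  note t = module_map_hom[OF n.\<alpha> Q(1)] module_map_hom[OF m.\<alpha> q] module_map_hom[OF m.\<alpha> Q(2)]
    module_map_hom[OF m.\<alpha> Q(3)] m.\<alpha>'[OF q] n.\<alpha>'[OF Q(1)] \<phi>h \<psi>h
    module_hom[OF m.M q Q(3) le(2)] module_hom[OF m.M' q Q(3) le(2)]
    module_hom[OF m.M Q(2,3) le(1)] module_hom[OF m.M' Q(2,3) le(1)]
  have "far M' (s, t) \<cdot> (\<alpha> s \<cdot> \<psi> r \<cdot> \<beta>' r) \<cdot> \<beta> r \<cdot> \<phi> q \<cdot> \<alpha>' q =
      far M' (s, t) \<cdot> \<alpha> s \<cdot> \<psi> r \<cdot> (\<beta>' r \<cdot> \<beta> r) \<cdot> \<phi> q \<cdot> \<alpha>' q"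
    using t by (simp add: hom_set_def)
  also have "\<dots> = (far M' (s, t) \<cdot> \<alpha> s) \<cdot> \<psi> r \<cdot> \<phi> q \<cdot> \<alpha>' q"
    using t by (simp only: n.\<alpha>'\<alpha>[OF Q(1)]) (simp add: hom_set_def)
  also have "\<dots> = (\<alpha> t \<cdot> far M (s, t)) \<cdot> \<psi> r \<cdot> \<phi> q \<cdot> \<alpha>' q"
    by (simp only: module_map_natural[OF m.\<alpha> Q(2,3) le(1)])
  also have "\<dots> = \<alpha> t \<cdot> (far M (s, t) \<cdot> \<psi> r \<cdot> \<phi> q) \<cdot> \<alpha>' q"
    using t by (simp add: hom_set_def)
  also have "far M (s, t) \<cdot> \<psi> r \<cdot> \<phi> q = far M (q, t)"
    using triangle q unfolding interleaving_triangle_def r_def s_def t_def by blast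
  also have "\<alpha> t \<cdot> far M (q, t) \<cdot> \<alpha>' q = (\<alpha> t \<cdot> far M (q, t)) \<cdot> \<alpha>' q"
    using t by (simp add: hom_set_def)
  also have "\<dots> = (far M' (q, t) \<cdot> \<alpha> q) \<cdot> \<alpha>' q"
    by (simp only: module_map_natural[OF m.\<alpha> q Q(3) le(2)])
  also have "\<dots> = far M' (q, t) \<cdot> (\<alpha> q \<cdot> \<alpha>' q)"
    using t by (simp add: hom_set_def)
  also have "\<dots> = far M' (q, t)"
    using t by (simp only: m.\<alpha>\<alpha>'[OF q]) (simp add: hom_set_def)
  finally show "far M' (T \<epsilon> (T \<epsilon> q), T (2 * \<epsilon>) q) \<cdot>
      (\<alpha> (T \<epsilon> (T \<epsilon> q)) \<cdot> \<psi> (T \<epsilon> q) \<cdot> \<beta>' (T \<epsilon> q)) \<cdot> \<beta> (T \<epsilon> q) \<cdot> \<phi> q \<cdot> \<alpha>' q =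
      far M' (q, T (2 * \<epsilon>) q)"
    by (simp add: r_def s_def t_def)
qed

end

lemma (in superlinear) weak_interleaving_transport:
  assumes m: "module_iso C Q M M' \<alpha> \<alpha>'" and n: "module_iso C Q N N' \<beta> \<beta>'"
    and \<epsilon>: "\<epsilon> \<ge> 0" and int: "weak_interleaving C Q T \<epsilon> M N \<phi> \<psi>"
  shows "\<exists>\<phi>' \<psi>'. weak_interleaving C Q T \<epsilon> M' N' \<phi>' \<psi>'"
proof -
  interpret m: module_iso C Q M M' \<alpha> \<alpha>' by (rule m)
  interpret n: module_iso C Q N N' \<beta> \<beta>' by (rule n)
  interpret mn: interleaving_transport Q T C M M' \<alpha> \<alpha>' N N' \<beta> \<beta>' ..
  interpret nm: interleaving_transport Q T C N N' \<beta> \<beta>' M M' \<alpha> \<alpha>' ..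
  show ?thesis
    using int \<epsilon> mn.conjugate_module_map nm.conjugate_module_map
      mn.conjugate_triangle nm.conjugate_triangle
    unfolding weak_interleaving_iff[OF m.M n.M \<epsilon>] weak_interleaving_iff[OF m.M' n.M' \<epsilon>]
    by blast
qed

lemma (in superlinear) weak_dist_iso:
  assumes m: "module_iso C Q M M' \<alpha> \<alpha>'" and n: "module_iso C Q N N' \<beta> \<beta>'"
  shows "weak_dist C Q T M N = weak_dist C Q T M' N'"
proof -
  note flipped = module_iso.flip[OF m] module_iso.flip[OF n]
  have "(\<exists>\<phi> \<psi>. weak_interleaving C Q T \<epsilon> M N \<phi> \<psi>) \<longleftrightarrow>
      (\<exists>\<phi> \<psi>. weak_interleaving C Q T \<epsilon> M' N' \<phi> \<psi>)" if "\<epsilon> \<ge> 0" for \<epsilon>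
    using weak_interleaving_transport[OF m n that] weak_interleaving_transport[OF flipped that]
    by blast
  then show ?thesis
    unfolding weak_dist_def by (metis (no_types, lifting))
qed

section \<open>Pushforwards\<close>

locale pushforward_setting = category C for C :: "('o, 'm) cat" +
  fixes P :: "'p::order set" and g :: "'p \<Rightarrow> 'q::order" and Q :: "'q set"
  assumes cocomplete: "cocomplete TYPE(('p, 'p \<times> 'p) cat) C"
    and g_in: "g ` P \<subseteq> Q" and g_mono: "mono_on P g"
begin

lemma g_mem: "p \<in> P \<Longrightarrow> g p \<in> Q"
  using g_in by blast

lemma is_cocone_poset_iff:
  "is_cocone C (poset_cat S) A L \<kappa> \<longleftrightarrow> L \<in> Ob C \<and> (\<forall>p\<in>S. \<kappa> p \<in> hom (fob A p) L) \<and>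
     (\<forall>p\<in>S. \<forall>p'\<in>S. p \<le> p' \<longrightarrow> \<kappa> p' \<cdot> far A (p, p') = \<kappa> p)"
  unfolding is_cocone_def poset_cat_def by auto

lemma is_colimit_colim:
  fixes S :: "'p set"
  assumes "is_module C S A"
  shows "is_colimit C (poset_cat S) A (colim C (poset_cat S) A) (coproj C (poset_cat S) A)"
proof -
  have "\<exists>x. case x of (L, \<kappa>) \<Rightarrow> is_colimit C (poset_cat S) A L \<kappa>"
    using cocomplete assms is_category_poset_cat unfolding cocomplete_def by auto
  from someI_ex[OF this]
  have "case chosen_colim C (poset_cat S) A of (L, \<kappa>) \<Rightarrow> is_colimit C (poset_cat S) A L \<kappa>"
    unfolding chosen_colim_def .
  then show ?thesis
    unfolding colim_def coproj_def by (cases "chosen_colim C (poset_cat S) A") simp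
qed

lemma is_cocone_coproj:
  fixes S :: "'p set"
  assumes "is_module C S A"
  shows "is_cocone C (poset_cat S) A (colim C (poset_cat S) A) (coproj C (poset_cat S) A)"
  using is_colimit_colim[OF assms] unfolding is_colimit_def by blast

lemma ex1_colimit_map:
  fixes S :: "'p set"
  assumes "is_module C S A" "is_cocone C (poset_cat S) A L \<kappa>"
  shows "\<exists>!h. h \<in> hom (colim C (poset_cat S) A) L \<and>
    (\<forall>p\<in>S. h \<cdot> coproj C (poset_cat S) A p = \<kappa> p)"
  using is_colimit_colim[OF assms(1)] assms(2) unfolding is_colimit_def
  by (simp add: poset_cat_def)

lemma colim_ext:
  fixes S :: "'p set"
  assumes A: "is_module C S A"
    and h: "h \<in> hom (colim C (poset_cat S) A) L" "h' \<in> hom (colim C (poset_cat S) A) L"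
    and eq: "\<And>p. p \<in> S \<Longrightarrow> h \<cdot> coproj C (poset_cat S) A p = h' \<cdot> coproj C (poset_cat S) A p"
  shows "h = h'"
proof -
  note c = is_cocone_coproj[OF A, unfolded is_cocone_poset_iff]
  have "is_cocone C (poset_cat S) A L (\<lambda>p. h \<cdot> coproj C (poset_cat S) A p)"
    unfolding is_cocone_poset_iff
  proof (intro conjI ballI impI)
    show "L \<in> Ob C" using hom_ob h by blast
    show "h \<cdot> coproj C (poset_cat S) A p \<in> hom (fob A p) L" if "p \<in> S" for p
      using that c h comp_hom by blast
    show "(h \<cdot> coproj C (poset_cat S) A p') \<cdot> far A (p, p') = h \<cdot> coproj C (poset_cat S) A p"
      if p: "p \<in> S" "p' \<in> S" "p \<le> p'" for p p'
      using comp_assoc[OF module_hom[OF A p] _ h(1)] c p by metis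
  qed
  from ex1_colimit_map[OF A this] show ?thesis using h eq by metis
qed

lemma
  fixes S :: "'p set"
  assumes A: "is_module C S A" and c: "is_cocone C (poset_cat S) A L \<kappa>"
  shows colim_desc_hom: "colim_desc C (poset_cat S) A L \<kappa> \<in> hom (colim C (poset_cat S) A) L"
    and colim_desc_coproj: "p \<in> S \<Longrightarrow>
      colim_desc C (poset_cat S) A L \<kappa> \<cdot> coproj C (poset_cat S) A p = \<kappa> p"
  using theI'[OF ex1_colimit_map[OF assms]]
  unfolding colim_desc_def by (simp_all add: poset_cat_def)

abbreviation push :: "('p, 'o, 'm) pmodule \<Rightarrow> ('q, 'o, 'm) pmodule" where
  "push A \<equiv> pushforward C P g A"

abbreviation incl :: "('p, 'o, 'm) pmodule \<Rightarrow> 'q \<Rightarrow> 'p \<Rightarrow> 'm" where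
  "incl A q \<equiv> coproj C (below P g q) A"

lemma push_fob: "fob (push A) q = colim C (poset_cat {p \<in> P. g p \<le> q}) A"
  by (simp add: pushforward_def below_def)

context
  fixes A :: "('p, 'o, 'm) pmodule"
  assumes A: "is_module C P A"
begin

lemma is_module_below: "is_module C {p \<in> P. g p \<le> q} A"
  by (rule is_module_subset[OF A]) auto

lemma is_cocone_below_iff:
  "is_cocone C (below P g q) A L \<kappa> \<longleftrightarrow> L \<in> Ob C \<and>
     (\<forall>p\<in>P. g p \<le> q \<longrightarrow> \<kappa> p \<in> hom (fob A p) L) \<and>
     (\<forall>p\<in>P. \<forall>p'\<in>P. g p \<le> q \<longrightarrow> g p' \<le> q \<longrightarrow> p \<le> p' \<longrightarrow> \<kappa> p' \<cdot> far A (p, p') = \<kappa> p)"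
  unfolding below_def is_cocone_poset_iff by blast

lemma push_ob: "fob (push A) q \<in> Ob C"
  using is_cocone_coproj[OF is_module_below[of q]] unfolding push_fob is_cocone_poset_iff by blast

lemma incl_hom: "p \<in> P \<Longrightarrow> g p \<le> q \<Longrightarrow> incl A q p \<in> hom (fob A p) (fob (push A) q)"
  using is_cocone_coproj[OF is_module_below[of q]] unfolding push_fob below_def is_cocone_poset_iff
  by blast

lemma incl_natural:
  "p \<in> P \<Longrightarrow> p' \<in> P \<Longrightarrow> p \<le> p' \<Longrightarrow> g p \<le> q \<Longrightarrow> g p' \<le> q \<Longrightarrow>
     incl A q p' \<cdot> far A (p, p') = incl A q p"
  using is_cocone_coproj[OF is_module_below[of q]] unfolding below_def is_cocone_poset_iff by blast

lemma push_ext: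
  assumes "h \<in> hom (fob (push A) q) L" "h' \<in> hom (fob (push A) q) L"
    and "\<And>p. p \<in> P \<Longrightarrow> g p \<le> q \<Longrightarrow> h \<cdot> incl A q p = h' \<cdot> incl A q p"
  shows "h = h'"
  using colim_ext[OF is_module_below[of q]] assms unfolding push_fob below_def by blast

lemma
  assumes "is_cocone C (below P g q) A L \<kappa>"
  shows desc_hom: "colim_desc C (below P g q) A L \<kappa> \<in> hom (fob (push A) q) L"
    and desc_incl: "p \<in> P \<Longrightarrow> g p \<le> q \<Longrightarrow> colim_desc C (below P g q) A L \<kappa> \<cdot> incl A q p = \<kappa> p"
  using colim_desc_hom[OF is_module_below[of q]] colim_desc_coproj[OF is_module_below[of q]] assms
  unfolding push_fob below_def by auto

lemma push_far: "far (push A) (q, q') = colim_desc C (below P g q) A (fob (push A) q') (incl A q')"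
  by (simp add: pushforward_def)

lemma is_cocone_incl:
  assumes "q \<le> q'"
  shows "is_cocone C (below P g q) A (fob (push A) q') (incl A q')"
proof -
  have "g p \<le> q'" if "g p \<le> q" for p using that assms by (rule order_trans)
  then show ?thesis
    unfolding is_cocone_below_iff by (simp add: push_ob incl_hom incl_natural)
qed

lemma push_far_hom: "q \<le> q' \<Longrightarrow> far (push A) (q, q') \<in> hom (fob (push A) q) (fob (push A) q')"
  unfolding push_far by (intro desc_hom is_cocone_incl)

lemma push_far_incl:
  "p \<in> P \<Longrightarrow> g p \<le> q \<Longrightarrow> q \<le> q' \<Longrightarrow> far (push A) (q, q') \<cdot> incl A q p = incl A q' p"
  unfolding push_far by (intro desc_incl is_cocone_incl)

lemma is_module_push: "is_module C R (push A)"
  unfolding is_module_iff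
proof (intro conjI ballI impI)
  fix p assume "p \<in> R"
  show "fob (push A) p \<in> Ob C" by (rule push_ob)
  show "far (push A) (p, p) = idt C (fob (push A) p)"
  proof (rule push_ext)
    show "far (push A) (p, p) \<in> hom (fob (push A) p) (fob (push A) p)"
      by (simp add: push_far_hom)
    show "idt C (fob (push A) p) \<in> hom (fob (push A) p) (fob (push A) p)"
      using is_category push_ob unfolding is_category_def by blast
    show "far (push A) (p, p) \<cdot> incl A p r = idt C (fob (push A) p) \<cdot> incl A p r"
      if "r \<in> P" "g r \<le> p" for r
      using that incl_hom[OF that] by (simp add: push_far_incl comp_id_left)
  qed
next
  show "far (push A) (p, q) \<in> hom (fob (push A) p) (fob (push A) q)" if "p \<le> q" for p q
    using that by (rule push_far_hom)
next
  fix p q r :: 'q assume le: "p \<le> q" "q \<le> r"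
  then have le': "p \<le> r" by (rule order_trans)
  show "far (push A) (p, r) = far (push A) (q, r) \<cdot> far (push A) (p, q)"
  proof (rule push_ext)
    show "far (push A) (p, r) \<in> hom (fob (push A) p) (fob (push A) r)"
      using le' by (rule push_far_hom)
    show "far (push A) (q, r) \<cdot> far (push A) (p, q) \<in> hom (fob (push A) p) (fob (push A) r)"
      using push_far_hom[OF le(1)] push_far_hom[OF le(2)] by (rule comp_hom)
    fix s assume s: "s \<in> P" "g s \<le> p"
    have s': "g s \<le> q" using s(2) le(1) by (rule order_trans)
    show "far (push A) (p, r) \<cdot> incl A p s = (far (push A) (q, r) \<cdot> far (push A) (p, q)) \<cdot> incl A p s"
      using comp_assoc[OF incl_hom[OF s] push_far_hom[OF le(1)] push_far_hom[OF le(2)]]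
      by (simp add: push_far_incl s s' le le')
  qed
qed

lemma unit_hom: "p \<in> P \<Longrightarrow> adj_unit C P g A p \<in> hom (fob A p) (fob (push A) (g p))"
  unfolding adj_unit_def by (simp add: incl_hom)

lemma push_far_unit:
  "p \<in> P \<Longrightarrow> g p \<le> q \<Longrightarrow> far (push A) (g p, q) \<cdot> adj_unit C P g A p = incl A q p"
  unfolding adj_unit_def by (simp add: push_far_incl)

text \<open>Precomposition with the unit is injective on natural maps out of a pushforward: naturality moves
  the value at any \<open>q\<close>, tested against a coprojection, to some \<open>g p \<le> q\<close>.\<close>

lemma push_map_ext:
  assumes B: "is_module C Q B"
    and \<sigma>: "is_module_map C Q (push A) B \<sigma>" and \<tau>: "is_module_map C Q (push A) B \<tau>"
    and eq: "\<And>p. p \<in> P \<Longrightarrow> \<sigma> (g p) \<cdot> adj_unit C P g A p = \<tau> (g p) \<cdot> adj_unit C P g A p"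
    and q: "q \<in> Q"
  shows "\<sigma> q = \<tau> q"
proof (rule push_ext)
  show "\<sigma> q \<in> hom (fob (push A) q) (fob B q)" "\<tau> q \<in> hom (fob (push A) q) (fob B q)"
    using module_map_hom \<sigma> \<tau> q by blast+
  fix p assume p: "p \<in> P" "g p \<le> q"
  note gp = g_mem[OF p(1)]
  have "\<rho> q \<cdot> incl A q p = far B (g p, q) \<cdot> \<rho> (g p) \<cdot> adj_unit C P g A p"
    if \<rho>: "is_module_map C Q (push A) B \<rho>" for \<rho>
  proof -
    note t = unit_hom[OF p(1)] push_far_hom[OF p(2)] module_map_hom[OF \<rho> q]
      module_map_hom[OF \<rho> gp] module_hom[OF B gp q p(2)]
    have "\<rho> q \<cdot> incl A q p = (\<rho> q \<cdot> far (push A) (g p, q)) \<cdot> adj_unit C P g A p"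
      using comp_assoc[OF t(1,2,3)] by (simp only: push_far_unit p)
    also have "\<dots> = far B (g p, q) \<cdot> \<rho> (g p) \<cdot> adj_unit C P g A p"
      using comp_assoc[OF t(1,4,5)] by (simp only: module_map_natural[OF \<rho> gp q p(2)])
    finally show ?thesis .
  qed
  from this[OF \<sigma>] this[OF \<tau>] show "\<sigma> q \<cdot> incl A q p = \<tau> q \<cdot> incl A q p"
    by (simp only: eq[OF p(1)])
qed

end

lemma unit_natural:
  assumes A: "is_module C P A"
  shows "is_module_map C P A (pullback g (push A)) (adj_unit C P g A)"
  unfolding is_module_map_iff pullback_simps
proof (intro conjI ballI impI)
  show "adj_unit C P g A p \<in> hom (fob A p) (fob (push A) (g p))" if "p \<in> P" for p
    using A that by (rule unit_hom)
  fix p q assume pq: "p \<in> P" "q \<in> P" "p \<le> q"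
  have le: "g p \<le> g q" using g_mono pq by (rule mono_onD)
  have "adj_unit C P g A q \<cdot> far A (p, q) = incl A (g q) p"
    unfolding adj_unit_def by (rule incl_natural[OF A pq le order_refl])
  then show "adj_unit C P g A q \<cdot> far A (p, q) = far (push A) (g p, g q) \<cdot> adj_unit C P g A p"
    by (simp only: push_far_unit[OF A pq(1) le])
qed

text \<open>The adjoint mate \<open>g\<^sub>* A \<rightarrow> B\<close> of a map \<open>A \<rightarrow> g\<^sup>* B\<close>.\<close>

definition mate :: "('p, 'o, 'm) pmodule \<Rightarrow> ('q, 'o, 'm) pmodule \<Rightarrow> ('p \<Rightarrow> 'm) \<Rightarrow> 'q \<Rightarrow> 'm" where
  "mate A B \<psi> q = adj_counit C P g B q \<cdot> pushforward_map C P g A (pullback g B) \<psi> q"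

lemma is_module_pull: "is_module C Q B \<Longrightarrow> is_module C P (pullback g B)"
  by (rule is_module_pullback[OF _ g_in g_mono])

lemma
  assumes B: "is_module C Q B" and q: "q \<in> Q"
  shows counit_hom: "adj_counit C P g B q \<in> hom (fob (push (pullback g B)) q) (fob B q)"
    and counit_incl: "p \<in> P \<Longrightarrow> g p \<le> q \<Longrightarrow>
      adj_counit C P g B q \<cdot> incl (pullback g B) q p = far B (g p, q)"
proof -
  note pB = is_module_pull[OF B]
  have "is_cocone C (below P g q) (pullback g B) (fob B q) (\<lambda>p. far B (g p, q))"
    unfolding is_cocone_below_iff[OF pB] pullback_simps
  proof (intro conjI ballI impI)
    show "fob B q \<in> Ob C" using B q by (rule module_ob)
    show "far B (g p, q) \<in> hom (fob B (g p)) (fob B q)" if "p \<in> P" "g p \<le> q" for p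
      by (rule module_hom[OF B g_mem[OF that(1)] q that(2)])
    show "far B (g p', q) \<cdot> far B (g p, g p') = far B (g p, q)"
      if "p \<in> P" "p' \<in> P" "g p' \<le> q" "p \<le> p'" for p p'
      by (rule module_comp[OF B g_mem[OF that(1)] g_mem[OF that(2)] q mono_onD[OF g_mono that(1,2,4)] that(3)])
  qed
  note c = this
  show "adj_counit C P g B q \<in> hom (fob (push (pullback g B)) q) (fob B q)"
    unfolding adj_counit_def by (rule desc_hom[OF pB c])
  show "p \<in> P \<Longrightarrow> g p \<le> q \<Longrightarrow>
      adj_counit C P g B q \<cdot> incl (pullback g B) q p = far B (g p, q)"
    unfolding adj_counit_def by (rule desc_incl[OF pB c])
qed

lemma (*M*)
  assumes A: "is_module C P A" and A': "is_module C P A'" and \<psi>: "is_module_map C P A A' \<psi>"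
  shows pushforward_map_hom: "pushforward_map C P g A A' \<psi> q \<in> hom (fob (push A) q) (fob (push A') q)"
    and pushforward_map_incl: "p \<in> P \<Longrightarrow> g p \<le> q \<Longrightarrow>
      pushforward_map C P g A A' \<psi> q \<cdot> incl A q p = incl A' q p \<cdot> \<psi> p"
proof -
  have "is_cocone C (below P g q) A (fob (push A') q) (vcomp C (incl A' q) \<psi>)"
    unfolding is_cocone_below_iff[OF A] vcomp_def
  proof (intro conjI ballI impI)
    show "fob (push A') q \<in> Ob C" by (rule push_ob[OF A'])
    show "incl A' q p \<cdot> \<psi> p \<in> hom (fob A p) (fob (push A') q)" if "p \<in> P" "g p \<le> q" for p
      using module_map_hom[OF \<psi> that(1)] incl_hom[OF A' that] by (rule comp_hom)
    fix p p' assume p: "p \<in> P" "p' \<in> P" "g p \<le> q" "g p' \<le> q" "p \<le> p'"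
    note t = module_hom[OF A p(1,2,5)] module_hom[OF A' p(1,2,5)] module_map_hom[OF \<psi> p(1)]
      module_map_hom[OF \<psi> p(2)] incl_hom[OF A' p(1,3)] incl_hom[OF A' p(2,4)]
    have "(incl A' q p' \<cdot> \<psi> p') \<cdot> far A (p, p') = incl A' q p' \<cdot> far A' (p, p') \<cdot> \<psi> p"
      using comp_assoc[OF t(1,4,6)] by (simp only: module_map_natural[OF \<psi> p(1,2,5)])
    also have "\<dots> = incl A' q p \<cdot> \<psi> p"
      using comp_assoc[OF t(3,2,6)] by (simp only: incl_natural[OF A' p(1,2,5,3,4)])
    finally show "(incl A' q p' \<cdot> \<psi> p') \<cdot> far A (p, p') = incl A' q p \<cdot> \<psi> p" .
  qed
  note c = this
  have eq: "pushforward_map C P g A A' \<psi> q =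
      colim_desc C (below P g q) A (fob (push A') q) (vcomp C (incl A' q) \<psi>)"
    by (simp add: pushforward_map_def pushforward_def)
  show "pushforward_map C P g A A' \<psi> q \<in> hom (fob (push A) q) (fob (push A') q)"
    unfolding eq by (rule desc_hom[OF A c])
  show "p \<in> P \<Longrightarrow> g p \<le> q \<Longrightarrow>
      pushforward_map C P g A A' \<psi> q \<cdot> incl A q p = incl A' q p \<cdot> \<psi> p"
    unfolding eq using desc_incl[OF A c, of p] by (simp only: vcomp_def)
qed

context
  fixes A B \<psi>
  assumes A: "is_module C P A" and B: "is_module C Q B"
    and \<psi>: "is_module_map C P A (pullback g B) \<psi>"
begin

lemma mate_hom: "q \<in> Q \<Longrightarrow> mate A B \<psi> q \<in> hom (fob (push A) q) (fob B q)"
  unfolding mate_def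
  by (rule comp_hom[OF pushforward_map_hom[OF A is_module_pull[OF B] \<psi>] counit_hom[OF B]])

lemma mate_incl:
  assumes q: "q \<in> Q" and p: "p \<in> P" "g p \<le> q"
  shows "mate A B \<psi> q \<cdot> incl A q p = far B (g p, q) \<cdot> \<psi> p"
proof -
  note pB = is_module_pull[OF B]
  note t = incl_hom[OF A p] pushforward_map_hom[OF A pB \<psi>, of q] counit_hom[OF B q]
    module_map_hom[OF \<psi> p(1)] incl_hom[OF pB p]
  have "mate A B \<psi> q \<cdot> incl A q p = adj_counit C P g B q \<cdot> incl (pullback g B) q p \<cdot> \<psi> p"
    unfolding mate_def using comp_assoc[OF t(1,2,3)]
    by (simp only: pushforward_map_incl[OF A pB \<psi> p])
  also have "\<dots> = far B (g p, q) \<cdot> \<psi> p"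
    using comp_assoc[OF t(4,5,3)] by (simp only: counit_incl[OF B q p])
  finally show ?thesis .
qed

lemma mate_unit:
  assumes p: "p \<in> P"
  shows "mate A B \<psi> (g p) \<cdot> adj_unit C P g A p = \<psi> p"
proof -
  note gp = g_mem[OF p]
  show ?thesis
    using module_map_hom[OF \<psi> p] unfolding adj_unit_def
    by (simp add: mate_incl gp p module_id[OF B] comp_id_left)
qed

lemma mate_natural: "is_module_map C Q (push A) B (mate A B \<psi>)"
  unfolding is_module_map_iff
proof (intro conjI ballI impI)
  show "mate A B \<psi> q \<in> hom (fob (push A) q) (fob B q)" if "q \<in> Q" for q
    using that by (rule mate_hom)
  fix q q' assume q: "q \<in> Q" "q' \<in> Q" "q \<le> q'"
  note t = push_far_hom[OF A q(3)] mate_hom[OF q(1)] mate_hom[OF q(2)] module_hom[OF B q]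
  show "mate A B \<psi> q' \<cdot> far (push A) (q, q') = far B (q, q') \<cdot> mate A B \<psi> q"
  proof (rule push_ext[OF A])
    show "mate A B \<psi> q' \<cdot> far (push A) (q, q') \<in> hom (fob (push A) q) (fob B q')"
      using t(1,3) by (rule comp_hom)
    show "far B (q, q') \<cdot> mate A B \<psi> q \<in> hom (fob (push A) q) (fob B q')"
      using t(2,4) by (rule comp_hom)
    fix p assume p: "p \<in> P" "g p \<le> q"
    note gp = g_mem[OF p(1)] and p' = order_trans[OF p(2) q(3)]
    note t' = incl_hom[OF A p] module_map_hom[OF \<psi> p(1)] module_hom[OF B gp q(1) p(2)]
    have "(mate A B \<psi> q' \<cdot> far (push A) (q, q')) \<cdot> incl A q p = far B (g p, q') \<cdot> \<psi> p"
      using comp_assoc[OF t'(1) t(1,3)] by (simp add: push_far_incl[OF A p q(3)] mate_incl q p p')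
    also have "\<dots> = far B (q, q') \<cdot> far B (g p, q) \<cdot> \<psi> p"
      using t' t(4) module_comp[OF B gp q(1,2) p(2) q(3)]
        comp_assoc[of "\<psi> p" _ _ "far B (g p, q)" _ "far B (q, q')"] by fastforce
    also have "\<dots> = (far B (q, q') \<cdot> mate A B \<psi> q) \<cdot> incl A q p"
      using comp_assoc[OF t'(1) t(2,4)] by (simp add: mate_incl q p)
    finally show "(mate A B \<psi> q' \<cdot> far (push A) (q, q')) \<cdot> incl A q p =
        (far B (q, q') \<cdot> mate A B \<psi> q) \<cdot> incl A q p" .
  qed
qed

end

lemma mate_of_restriction:
  assumes A: "is_module C P A" and B: "is_module C Q B"
    and \<sigma>: "is_module_map C Q (push A) B \<sigma>"
  defines "\<psi> \<equiv> \<lambda>p. \<sigma> (g p) \<cdot> adj_unit C P g A p"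
  shows "is_module_map C P A (pullback g B) \<psi>" and "q \<in> Q \<Longrightarrow> mate A B \<psi> q = \<sigma> q"
proof -
  show \<psi>: "is_module_map C P A (pullback g B) \<psi>"
    unfolding \<psi>_def
    by (rule module_map_comp[OF A is_module_pull[OF is_module_push[OF A]] is_module_pull[OF B]
          unit_natural[OF A] module_map_pullback[OF \<sigma> g_in g_mono]])
  show "mate A B \<psi> q = \<sigma> q" if "q \<in> Q"
    using push_map_ext[OF A B mate_natural[OF A B \<psi>] \<sigma> _ that] mate_unit[OF A B \<psi>]
    by (simp add: \<psi>_def)
qed

lemma counit_natural:
  assumes B: "is_module C Q B"
  shows "is_module_map C Q (push (pullback g B)) B (adj_counit C P g B)"
  unfolding is_module_map_iff
proof (intro conjI ballI impI)
  note pB = is_module_pull[OF B]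
  show "adj_counit C P g B q \<in> hom (fob (push (pullback g B)) q) (fob B q)" if "q \<in> Q" for q
    using B that by (rule counit_hom)
  fix q q' assume q: "q \<in> Q" "q' \<in> Q" "q \<le> q'"
  note t = push_far_hom[OF pB q(3)] counit_hom[OF B q(1)] counit_hom[OF B q(2)] module_hom[OF B q]
  show "adj_counit C P g B q' \<cdot> far (push (pullback g B)) (q, q') =
      far B (q, q') \<cdot> adj_counit C P g B q"
  proof (rule push_ext[OF pB])
    show "adj_counit C P g B q' \<cdot> far (push (pullback g B)) (q, q')
        \<in> hom (fob (push (pullback g B)) q) (fob B q')"
      using t(1,3) by (rule comp_hom)
    show "far B (q, q') \<cdot> adj_counit C P g B q \<in> hom (fob (push (pullback g B)) q) (fob B q')"
      using t(2,4) by (rule comp_hom)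
    fix p assume p: "p \<in> P" "g p \<le> q"
    note gp = g_mem[OF p(1)] and p' = order_trans[OF p(2) q(3)]
    show "(adj_counit C P g B q' \<cdot> far (push (pullback g B)) (q, q')) \<cdot> incl (pullback g B) q p =
        (far B (q, q') \<cdot> adj_counit C P g B q) \<cdot> incl (pullback g B) q p"
      using comp_assoc[OF incl_hom[OF pB p] t(1,3)] comp_assoc[OF incl_hom[OF pB p] t(2,4)]
      by (simp add: push_far_incl[OF pB p q(3)] counit_incl[OF B] q p p' gp module_comp[OF B])
  qed
qed

lemma counit_module_iso:
  assumes B: "is_module C Q B" and iso: "\<And>q. q \<in> Q \<Longrightarrow> is_iso C (adj_counit C P g B q)"
  obtains \<alpha>' where "module_iso C Q (push (pullback g B)) B (adj_counit C P g B) \<alpha>'"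
proof -
  note pB = is_module_pull[OF B]
  have "\<forall>q\<in>Q. \<exists>h. h \<in> hom (fob B q) (fob (push (pullback g B)) q) \<and>
      h \<cdot> adj_counit C P g B q = idt C (fob (push (pullback g B)) q) \<and>
      adj_counit C P g B q \<cdot> h = idt C (fob B q)"
    using is_isoE[OF iso counit_hom[OF B]] by metis
  then obtain \<alpha>' where \<alpha>': "\<forall>q\<in>Q. \<alpha>' q \<in> hom (fob B q) (fob (push (pullback g B)) q) \<and>
      \<alpha>' q \<cdot> adj_counit C P g B q = idt C (fob (push (pullback g B)) q) \<and>
      adj_counit C P g B q \<cdot> \<alpha>' q = idt C (fob B q)"
    by (rule bchoice[THEN exE])
  have "module_iso C Q (push (pullback g B)) B (adj_counit C P g B) \<alpha>'"
    by unfold_locales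
      (simp_all only: B is_module_push[OF pB] counit_natural[OF B] \<alpha>'[rule_format])
  then show thesis by (rule that)
qed

end

section \<open>Relative interleavings are interleavings of pushforwards\<close>

locale relative_setting = pushforward_setting C P g Q + superlinear Q T
  for C :: "('o, 'm) cat" and P :: "'p::order set" and g :: "'p \<Rightarrow> 'q::order" and Q T
begin

context
  fixes A B :: "('p, 'o, 'm) pmodule" and \<epsilon> :: real and \<phi> \<psi> :: "'p \<Rightarrow> 'm"
  assumes A: "is_module C P A" and B: "is_module C P B" and \<epsilon>: "\<epsilon> \<ge> 0"
    and \<phi>: "is_module_map C P A (rel_shift C P g T \<epsilon> B) \<phi>"
    and \<psi>: "is_module_map C P B (rel_shift C P g T \<epsilon> A) \<psi>"
begin

text \<open>The map \<open>\<Sigma>\<close> of the relative setting contains a counit, which after \<open>g\<^sub>* \<psi>\<close> gives the mate of \<open>\<psi>\<close>.\<close>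

lemma rel_composite:
  assumes p: "p \<in> P"
  shows "vcomp C (rel_Sig C P g T \<epsilon> \<epsilon> A)
      (vcomp C (rel_shift_map C P g T \<epsilon> B (rel_shift C P g T \<epsilon> A) \<psi>) \<phi>) p =
    far (push A) (T \<epsilon> (T \<epsilon> (g p)), T (2 * \<epsilon>) (g p)) \<cdot>
      mate B (shift T \<epsilon> (push A)) \<psi> (T \<epsilon> (g p)) \<cdot> \<phi> p"
proof -
  define r where "r = T \<epsilon> (g p)"
  have gp: "g p \<in> Q" and r: "r \<in> Q" and le: "T \<epsilon> r \<le> T (2 * \<epsilon>) (g p)"
    unfolding r_def by (intro g_mem[OF p] T_in[OF \<epsilon>] T_T_le_double[OF \<epsilon>])+
  note sA = is_module_shift[OF is_module_push[OF A] \<epsilon>]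
  note t = module_map_hom[OF \<phi> p] counit_hom[OF sA r] push_far_hom[OF A le]
    pushforward_map_hom[OF B is_module_pull[OF sA] \<psi>[unfolded rel_shift_def], of r]
  have "vcomp C (rel_Sig C P g T \<epsilon> \<epsilon> A)
      (vcomp C (rel_shift_map C P g T \<epsilon> B (rel_shift C P g T \<epsilon> A) \<psi>) \<phi>) p =
    (far (push A) (T \<epsilon> r, T (2 * \<epsilon>) (g p)) \<cdot> adj_counit C P g (shift T \<epsilon> (push A)) r) \<cdot>
      pushforward_map C P g B (pullback g (shift T \<epsilon> (push A))) \<psi> r \<cdot> \<phi> p"
    by (simp only: vcomp_def rel_Sig_def rel_shift_map_def pullback_map_def shift_map_def Sig_def
        rel_shift_def r_def mult_2)
  also have "\<dots> = far (push A) (T \<epsilon> r, T (2 * \<epsilon>) (g p)) \<cdot> mate B (shift T \<epsilon> (push A)) \<psi> r \<cdot> \<phi> p"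
    unfolding mate_def using t by (simp add: hom_set_def rel_shift_def r_def)
  finally show ?thesis unfolding r_def .
qed

lemma rel_internal:
  assumes p: "p \<in> P"
  shows "vcomp C (rel_eta2 C P g T 0 (2 * \<epsilon>) A) (rel_eta C P g T 0 A) p =
    far (push A) (g p, T (2 * \<epsilon>) (g p)) \<cdot> adj_unit C P g A p"
proof -
  have gp: "g p \<in> Q" using p by (rule g_mem)
  have le: "g p \<le> T 0 (g p)" "T 0 (g p) \<le> T (2 * \<epsilon>) (g p)"
    using T_ge[OF order_refl gp] T_mono_param[OF order_refl _ gp, of "2 * \<epsilon>"] \<epsilon> by auto
  have Q: "T 0 (g p) \<in> Q" "T (2 * \<epsilon>) (g p) \<in> Q"
    using \<epsilon> by (auto intro: T_in gp)
  show ?thesis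
    unfolding vcomp_def rel_eta2_def rel_eta_def pullback_map_def eta2_def eta_def
    using comp_assoc[OF unit_hom[OF A p] push_far_hom[OF A le(1)] push_far_hom[OF A le(2)]]
    by (simp only: module_comp[OF is_module_push[OF A] gp Q le])
qed

text \<open>Both sides of a triangle are natural maps out of \<open>g\<^sub>* A\<close>, so they agree as soon as they do after
  the unit; and after the unit the mate of \<open>\<phi>\<close> is \<open>\<phi>\<close>.\<close>

lemma rel_triangle_iff:
  "(\<forall>p\<in>P. vcomp C (rel_Sig C P g T \<epsilon> \<epsilon> A)
        (vcomp C (rel_shift_map C P g T \<epsilon> B (rel_shift C P g T \<epsilon> A) \<psi>) \<phi>) p =
      vcomp C (rel_eta2 C P g T 0 (2 * \<epsilon>) A) (rel_eta C P g T 0 A) p) \<longleftrightarrow>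
   interleaving_triangle C Q T \<epsilon> (push A)
     (mate A (shift T \<epsilon> (push B)) \<phi>) (mate B (shift T \<epsilon> (push A)) \<psi>)"
  (is "?rel \<longleftrightarrow> ?triangle")
proof -
  note pA = is_module_push[OF A, of Q] and pB = is_module_push[OF B, of Q]
  have \<epsilon>2: "2 * \<epsilon> \<ge> 0" using \<epsilon> by simp
  note sA = is_module_shift[OF pA \<epsilon>] and sB = is_module_shift[OF pB \<epsilon>]
    and s2A = is_module_shift[OF pA \<epsilon>2]
  define \<Phi> where "\<Phi> = mate A (shift T \<epsilon> (push B)) \<phi>"
  define \<Psi> where "\<Psi> = mate B (shift T \<epsilon> (push A)) \<psi>"
  note \<phi>' = \<phi>[unfolded rel_shift_def] and \<psi>' = \<psi>[unfolded rel_shift_def]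
  have \<Phi>: "is_module_map C Q (push A) (shift T \<epsilon> (push B)) \<Phi>"
    unfolding \<Phi>_def by (rule mate_natural[OF A sB \<phi>'])
  have \<Psi>: "is_module_map C Q (push B) (shift T \<epsilon> (push A)) \<Psi>"
    unfolding \<Psi>_def by (rule mate_natural[OF B sA \<psi>'])
  define l where "l q = far (push A) (T \<epsilon> (T \<epsilon> q), T (2 * \<epsilon>) q) \<cdot> \<Psi> (T \<epsilon> q) \<cdot> \<Phi> q" for q
  define r where "r q = far (push A) (q, T (2 * \<epsilon>) q)" for q
  have sig: "is_module_map C Q (shift T \<epsilon> (shift T \<epsilon> (push A))) (shift T (2 * \<epsilon>) (push A))
      (\<lambda>q. far (push A) (T \<epsilon> (T \<epsilon> q), T (2 * \<epsilon>) q))"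
    using module_map_internal[OF pA, of "\<lambda>q. T \<epsilon> (T \<epsilon> q)" Q "T (2 * \<epsilon>)"] \<epsilon> \<epsilon>2
    by (simp add: is_module_map_iff image_subset_iff T_in mono_on_def T_mono T_T_le_double)
  have l: "is_module_map C Q (push A) (shift T (2 * \<epsilon>) (push A)) l"
    unfolding l_def
    by (rule module_map_comp[OF pA is_module_shift[OF sA \<epsilon>] s2A
          module_map_comp[OF pA sB is_module_shift[OF sA \<epsilon>] \<Phi> module_map_shift[OF \<Psi> \<epsilon>]] sig])
  have r: "is_module_map C Q (push A) (shift T (2 * \<epsilon>) (push A)) r"
    using module_map_internal[OF pA, of "\<lambda>q. q" Q "T (2 * \<epsilon>)"] \<epsilon>2
    unfolding r_def by (simp add: is_module_map_iff image_subset_iff T_in mono_on_def T_mono T_ge)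
  have unit: "l (g p) \<cdot> adj_unit C P g A p =
      far (push A) (T \<epsilon> (T \<epsilon> (g p)), T (2 * \<epsilon>) (g p)) \<cdot> \<Psi> (T \<epsilon> (g p)) \<cdot> \<phi> p" if p: "p \<in> P" for p
  proof -
    have gp: "g p \<in> Q" using p by (rule g_mem)
    note t = unit_hom[OF A p] module_map_hom[OF \<Phi> gp] module_map_hom[OF \<Psi> T_in[OF \<epsilon> gp]]
      push_far_hom[OF A T_T_le_double[OF \<epsilon> gp]]
    have "l (g p) \<cdot> adj_unit C P g A p = far (push A) (T \<epsilon> (T \<epsilon> (g p)), T (2 * \<epsilon>) (g p)) \<cdot>
        \<Psi> (T \<epsilon> (g p)) \<cdot> (\<Phi> (g p) \<cdot> adj_unit C P g A p)"
      unfolding l_def using t by (simp add: hom_set_def)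
    then show ?thesis unfolding \<Phi>_def by (simp only: mate_unit[OF A sB \<phi>' p])
  qed
  have "?rel \<longleftrightarrow> (\<forall>p\<in>P. l (g p) \<cdot> adj_unit C P g A p = r (g p) \<cdot> adj_unit C P g A p)"
    by (intro ball_cong refl) (simp only: rel_composite rel_internal unit r_def \<Psi>_def)
  also have "\<dots> \<longleftrightarrow> (\<forall>q\<in>Q. l q = r q)"
    using push_map_ext[OF A s2A l r] g_mem by metis
  also have "\<dots> \<longleftrightarrow> ?triangle"
    unfolding interleaving_triangle_def l_def r_def \<Phi>_def \<Psi>_def ..
  finally show ?thesis .
qed

end

text \<open>By adjunction, maps \<open>A \<rightarrow> g\<^sup>* (g\<^sub>* B)\<^sup>\<epsilon>\<close> are the same as maps \<open>g\<^sub>* A \<rightarrow> (g\<^sub>* B)\<^sup>\<epsilon>\<close>, and the defining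
  equations match.\<close>

lemma weak_rel_interleaving_iff_pushforward:
  assumes A: "is_module C P A" and B: "is_module C P B" and \<epsilon>: "\<epsilon> \<ge> 0"
  shows "(\<exists>\<phi> \<psi>. weak_rel_interleaving C P g T \<epsilon> A B \<phi> \<psi>) \<longleftrightarrow>
    (\<exists>\<phi> \<psi>. weak_interleaving C Q T \<epsilon> (push A) (push B) \<phi> \<psi>)"
proof -
  note pA = is_module_push[OF A, of Q] and pB = is_module_push[OF B, of Q]
  note sA = is_module_shift[OF pA \<epsilon>] and sB = is_module_shift[OF pB \<epsilon>]
  note iff = weak_interleaving_iff[OF pA pB \<epsilon>]
  show ?thesis
  proof (intro iffI; elim exE)
    fix \<phi> \<psi> assume int: "weak_rel_interleaving C P g T \<epsilon> A B \<phi> \<psi>"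
    then have maps: "is_module_map C P A (rel_shift C P g T \<epsilon> B) \<phi>"
        "is_module_map C P B (rel_shift C P g T \<epsilon> A) \<psi>"
      by (simp_all only: weak_rel_interleaving_def)
    note maps' = maps[unfolded rel_shift_def]
    have "weak_interleaving C Q T \<epsilon> (push A) (push B)
        (mate A (shift T \<epsilon> (push B)) \<phi>) (mate B (shift T \<epsilon> (push A)) \<psi>)"
      using int mate_natural[OF A sB maps'(1)] mate_natural[OF B sA maps'(2)]
      by (simp only: iff weak_rel_interleaving_def rel_triangle_iff[OF A B \<epsilon> maps]
          rel_triangle_iff[OF B A \<epsilon> maps(2,1)])
    then show "\<exists>\<phi> \<psi>. weak_interleaving C Q T \<epsilon> (push A) (push B) \<phi> \<psi>" by blast
  next
    fix \<sigma> \<tau> assume int: "weak_interleaving C Q T \<epsilon> (push A) (push B) \<sigma> \<tau>"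
    then have maps: "is_module_map C Q (push A) (shift T \<epsilon> (push B)) \<sigma>"
        "is_module_map C Q (push B) (shift T \<epsilon> (push A)) \<tau>"
      and triangles: "interleaving_triangle C Q T \<epsilon> (push A) \<sigma> \<tau>"
        "interleaving_triangle C Q T \<epsilon> (push B) \<tau> \<sigma>"
      by (simp_all only: iff)
    define \<phi> where "\<phi> p = \<sigma> (g p) \<cdot> adj_unit C P g A p" for p
    define \<psi> where "\<psi> p = \<tau> (g p) \<cdot> adj_unit C P g B p" for p
    note \<phi> = mate_of_restriction[OF A sB maps(1), folded \<phi>_def]
    note \<psi> = mate_of_restriction[OF B sA maps(2), folded \<psi>_def]
    note maps' = \<phi>(1)[folded rel_shift_def] \<psi>(1)[folded rel_shift_def]
    have "interleaving_triangle C Q T \<epsilon> (push A)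
          (mate A (shift T \<epsilon> (push B)) \<phi>) (mate B (shift T \<epsilon> (push A)) \<psi>)"
        "interleaving_triangle C Q T \<epsilon> (push B)
          (mate B (shift T \<epsilon> (push A)) \<psi>) (mate A (shift T \<epsilon> (push B)) \<phi>)"
      using triangles unfolding interleaving_triangle_def by (simp_all add: \<phi>(2) \<psi>(2) T_in[OF \<epsilon>])
    then have "weak_rel_interleaving C P g T \<epsilon> A B \<phi> \<psi>"
      using maps' by (simp only: weak_rel_interleaving_def rel_triangle_iff[OF A B \<epsilon> maps']
          rel_triangle_iff[OF B A \<epsilon> maps'(2,1)])
    then show "\<exists>\<phi> \<psi>. weak_rel_interleaving C P g T \<epsilon> A B \<phi> \<psi>" by blast
  qed
qed

lemma weak_rel_dist_eq_pushforward:
  assumes "is_module C P A" "is_module C P B"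
  shows "weak_rel_dist C P g T A B = weak_dist C Q T (push A) (push B)"
proof -
  have "{ennreal \<epsilon> | \<epsilon>. \<epsilon> \<ge> 0 \<and> (\<exists>\<phi> \<psi>. weak_rel_interleaving C P g T \<epsilon> A B \<phi> \<psi>)} =
      {ennreal \<epsilon> | \<epsilon>. \<epsilon> \<ge> 0 \<and> (\<exists>\<phi> \<psi>. weak_interleaving C Q T \<epsilon> (push A) (push B) \<phi> \<psi>)}"
    by (intro Collect_cong ex_cong1 conj_cong refl) (rule weak_rel_interleaving_iff_pushforward[OF assms])
  then show ?thesis unfolding weak_rel_dist_def weak_dist_def by simp
qed

text \<open>When the counits \<open>g\<^sub>* g\<^sup>* M \<rightarrow> M\<close> and \<open>g\<^sub>* g\<^sup>* N \<rightarrow> N\<close> are invertible, nothing is lost by restricting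
  along \<open>g\<close>.\<close>

theorem weak_rel_dist_pullback:
  assumes M: "is_module C Q M" and N: "is_module C Q N"
    and iso: "\<And>q. q \<in> Q \<Longrightarrow> is_iso C (adj_counit C P g M q)"
      "\<And>q. q \<in> Q \<Longrightarrow> is_iso C (adj_counit C P g N q)"
  shows "weak_rel_dist C P g T (pullback g M) (pullback g N) = weak_dist C Q T M N"
proof -
  obtain \<alpha>' where m: "module_iso C Q (push (pullback g M)) M (adj_counit C P g M) \<alpha>'"
    using counit_module_iso[OF M iso(1)] .
  obtain \<beta>' where n: "module_iso C Q (push (pullback g N)) N (adj_counit C P g N) \<beta>'"
    using counit_module_iso[OF N iso(2)] .
  show ?thesis
    unfolding weak_rel_dist_eq_pushforward[OF is_module_pull[OF M] is_module_pull[OF N]]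
    by (rule weak_dist_iso[OF m n])
qed

end

section \<open>Approximating a superlinear family on a subposet\<close>

lemma weak_dist_le_add:
  assumes \<delta>: "\<delta> \<ge> 0"
    and transfer: "\<And>\<epsilon> \<phi> \<psi>. \<epsilon> \<ge> 0 \<Longrightarrow> weak_interleaving C Q T \<epsilon> M N \<phi> \<psi> \<Longrightarrow>
      \<exists>\<phi>' \<psi>'. weak_interleaving C Q' T' (\<epsilon> + \<delta>) M' N' \<phi>' \<psi>'"
  shows "weak_dist C Q' T' M' N' \<le> weak_dist C Q T M N + ennreal \<delta>"
proof -
  have "weak_dist C Q' T' M' N' - ennreal \<delta> \<le> weak_dist C Q T M N"
    unfolding weak_dist_def[of C Q T]
  proof (rule Inf_greatest)
    fix e assume "e \<in> {ennreal \<epsilon> | \<epsilon>. \<epsilon> \<ge> 0 \<and> (\<exists>\<phi> \<psi>. weak_interleaving C Q T \<epsilon> M N \<phi> \<psi>)}"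
    then obtain \<epsilon> \<phi> \<psi> where e: "e = ennreal \<epsilon>" "\<epsilon> \<ge> 0"
      and int: "weak_interleaving C Q T \<epsilon> M N \<phi> \<psi>" by auto
    have "weak_dist C Q' T' M' N' \<le> ennreal (\<epsilon> + \<delta>)"
      unfolding weak_dist_def
    proof (intro Inf_lower CollectI exI[of _ "\<epsilon> + \<delta>"] conjI refl)
      show "0 \<le> \<epsilon> + \<delta>" using e(2) \<delta> by simp
    qed (rule transfer[OF e(2) int])
    then show "weak_dist C Q' T' M' N' - ennreal \<delta> \<le> e"
      using e \<delta> by (simp add: ennreal_minus_le_iff ennreal_plus add.commute)
  qed
  then show ?thesis by (simp add: ennreal_minus_le_iff add.commute)
qed

text \<open>The family \<open>S\<close> takes values in \<open>L\<close>, lies below \<open>T\<close>, and catches up with it after increasing the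
  parameter by \<open>\<delta>\<close>. It is defined on all of \<open>Q\<close>, since extending a map from \<open>L\<close> to \<open>Q\<close> uses \<open>S \<delta>\<close> there.\<close>

locale approximation = category C + T: superlinear Q T + S: superlinear L S
  for C :: "('o, 'm) cat" and Q :: "'q::order set" and T and L :: "'q set" and S +
  fixes \<delta> :: real
  assumes L_subset: "L \<subseteq> Q" and \<delta>: "\<delta> \<ge> 0"
    and S_image: "\<And>\<epsilon>. \<epsilon> \<ge> 0 \<Longrightarrow> S \<epsilon> ` Q \<subseteq> L" and S_mono: "\<And>\<epsilon>. \<epsilon> \<ge> 0 \<Longrightarrow> mono_on Q (S \<epsilon>)"
    and S_le_T: "\<And>\<epsilon> q. \<epsilon> \<ge> 0 \<Longrightarrow> q \<in> Q \<Longrightarrow> S \<epsilon> q \<le> T \<epsilon> q"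
    and T_le_S: "\<And>\<epsilon> q. \<epsilon> \<ge> 0 \<Longrightarrow> q \<in> Q \<Longrightarrow> T \<epsilon> q \<le> S (\<epsilon> + \<delta>) q"
begin

lemma L_in: "q \<in> L \<Longrightarrow> q \<in> Q"
  using L_subset by blast

lemma S_in: "\<epsilon> \<ge> 0 \<Longrightarrow> q \<in> Q \<Longrightarrow> S \<epsilon> q \<in> L"
  using S_image by blast

lemma S_in_Q: "\<epsilon> \<ge> 0 \<Longrightarrow> q \<in> Q \<Longrightarrow> S \<epsilon> q \<in> Q"
  by (rule L_in[OF S_in])

lemma le_S_\<delta>: "q \<in> Q \<Longrightarrow> q \<le> S \<delta> q"
  using T.T_ge[of 0 q] T_le_S[of 0 q] by simp

text \<open>Restricting to \<open>L\<close>: extend the target of \<open>\<phi>\<close> along \<open>T \<epsilon> \<le> S (\<epsilon> + \<delta>)\<close>.\<close>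

definition restrict_map :: "real \<Rightarrow> ('q, 'o, 'm) pmodule \<Rightarrow> ('q \<Rightarrow> 'm) \<Rightarrow> 'q \<Rightarrow> 'm" where
  "restrict_map \<epsilon> N \<phi> q = far N (T \<epsilon> q, S (\<epsilon> + \<delta>) q) \<cdot> \<phi> q"

text \<open>Extending to \<open>Q\<close>: enlarge an element to \<open>S \<delta> v\<close>, which lies in \<open>L\<close>, before applying \<open>\<phi>\<close>.\<close>

definition extend_map ::
    "real \<Rightarrow> ('q, 'o, 'm) pmodule \<Rightarrow> ('q, 'o, 'm) pmodule \<Rightarrow> ('q \<Rightarrow> 'm) \<Rightarrow> 'q \<Rightarrow> 'm" where
  "extend_map \<epsilon> M N \<phi> v =
     far N (S \<epsilon> (S \<delta> v), T (\<epsilon> + \<delta>) v) \<cdot> \<phi> (S \<delta> v) \<cdot> far M (v, S \<delta> v)"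

lemma S_S_le_T:
  assumes "\<epsilon> \<ge> 0" "v \<in> Q"
  shows "S \<epsilon> (S \<delta> v) \<le> T (\<epsilon> + \<delta>) v"
proof -
  have s: "S \<delta> v \<in> Q" using \<delta> assms(2) by (rule S_in_Q)
  have "S \<epsilon> (S \<delta> v) \<le> T \<epsilon> (S \<delta> v)" using assms s by (intro S_le_T)
  also have "\<dots> \<le> T \<epsilon> (T \<delta> v)" using assms \<delta> s by (intro T.T_mono S_le_T T.T_in)
  also have "\<dots> \<le> T (\<delta> + \<epsilon>) v" using assms \<delta> by (intro T.T_T_le)
  finally show ?thesis by (simp add: add.commute)
qed

context
  fixes M N :: "('q, 'o, 'm) pmodule" and \<epsilon> :: real
  assumes M: "is_module C Q M" and N: "is_module C Q N" and \<epsilon>: "\<epsilon> \<ge> 0"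
begin

lemma restrict_map_natural:
  assumes \<phi>: "is_module_map C Q M (shift T \<epsilon> N) \<phi>"
  shows "is_module_map C L M (shift S (\<epsilon> + \<delta>) N) (restrict_map \<epsilon> N \<phi>)"
proof -
  have \<epsilon>\<delta>: "\<epsilon> + \<delta> \<ge> 0" using \<epsilon> \<delta> by simp
  have TL: "T \<epsilon> ` L \<subseteq> Q" "mono_on L (T \<epsilon>)"
    using T.T_image[OF \<epsilon>] T.mono_on_T[OF \<epsilon>] L_subset by (auto intro: mono_on_subset)
  have SL: "S (\<epsilon> + \<delta>) ` L \<subseteq> Q" "mono_on L (S (\<epsilon> + \<delta>))"
    using S.T_image[OF \<epsilon>\<delta>] S.mono_on_T[OF \<epsilon>\<delta>] L_subset by auto
  have \<phi>L: "is_module_map C L M (pullback (T \<epsilon>) N) \<phi>"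
    using \<phi> L_in by (simp add: is_module_map_iff)
  have le: "T \<epsilon> q \<le> S (\<epsilon> + \<delta>) q" if "q \<in> L" for q
    using T_le_S[OF \<epsilon> L_in[OF that]] .
  show ?thesis
    unfolding restrict_map_def shift_def
    by (rule module_map_comp[OF is_module_subset[OF M L_subset] is_module_pullback[OF N TL]
          is_module_pullback[OF N SL] \<phi>L module_map_internal[OF N TL SL le]])
qed

lemma extend_map_natural:
  assumes \<phi>: "is_module_map C L M (shift S \<epsilon> N) \<phi>"
  shows "is_module_map C Q M (shift T (\<epsilon> + \<delta>) N) (extend_map \<epsilon> M N \<phi>)"
proof -
  have \<epsilon>\<delta>: "\<epsilon> + \<delta> \<ge> 0" using \<epsilon> \<delta> by simp
  have id: "(\<lambda>v. v) ` Q \<subseteq> Q" "mono_on Q (\<lambda>v. v)" by (simp_all add: mono_on_def)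
  have S\<delta>: "S \<delta> ` Q \<subseteq> Q" "mono_on Q (S \<delta>)"
    using S_image[OF \<delta>] S_mono[OF \<delta>] L_subset by auto
  have SS: "(\<lambda>v. S \<epsilon> (S \<delta> v)) ` Q \<subseteq> Q" "mono_on Q (\<lambda>v. S \<epsilon> (S \<delta> v))"
  proof -
    show "(\<lambda>v. S \<epsilon> (S \<delta> v)) ` Q \<subseteq> Q"
      unfolding image_subset_iff by (intro ballI S_in_Q \<epsilon> \<delta>)
    show "mono_on Q (\<lambda>v. S \<epsilon> (S \<delta> v))"
      by (intro mono_onI S.T_mono S_in mono_onD[OF S\<delta>(2)] \<epsilon> \<delta>)
  qed
  note TT = T.T_image[OF \<epsilon>\<delta>] T.mono_on_T[OF \<epsilon>\<delta>]
  have eq: "pullback (\<lambda>v. v) M = M" "pullback (S \<delta>) (shift S \<epsilon> N) = pullback (\<lambda>v. S \<epsilon> (S \<delta> v)) N"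
    by (simp_all add: pullback_def shift_def case_prod_beta)
  note \<phi>S = module_map_pullback[OF \<phi> S_image[OF \<delta>] S_mono[OF \<delta>], unfolded eq]
  note up = module_map_internal[OF M id S\<delta> le_S_\<delta>, unfolded eq]
  show ?thesis
    unfolding extend_map_def shift_def
    by (rule module_map_comp[OF M is_module_pullback[OF N SS] is_module_pullback[OF N TT]
          module_map_comp[OF M is_module_pullback[OF M S\<delta>] is_module_pullback[OF N SS] up \<phi>S]
          module_map_internal[OF N SS TT S_S_le_T[OF \<epsilon>]]])
qed

text \<open>By naturality of \<open>\<psi>\<close>, the comparison maps move to the end, where only the triangle of \<open>\<phi>\<close> and \<open>\<psi>\<close>
  and internal maps of \<open>M\<close> remain.\<close>

lemma restrict_map_triangle:
  assumes \<phi>: "is_module_map C Q M (shift T \<epsilon> N) \<phi>" and \<psi>: "is_module_map C Q N (shift T \<epsilon> M) \<psi>"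
    and triangle: "interleaving_triangle C Q T \<epsilon> M \<phi> \<psi>"
  shows "interleaving_triangle C L S (\<epsilon> + \<delta>) M (restrict_map \<epsilon> N \<phi>) (restrict_map \<epsilon> M \<psi>)"
  unfolding interleaving_triangle_def
proof
  fix q assume qL: "q \<in> L"
  have \<epsilon>\<delta>: "\<epsilon> + \<delta> \<ge> 0" and \<epsilon>2: "2 * \<epsilon> \<ge> 0" "2 * (\<epsilon> + \<delta>) \<ge> 0" using \<epsilon> \<delta> by simp_all
  define r s u t where "r = T \<epsilon> q" and "s = S (\<epsilon> + \<delta>) q" and "u = S (\<epsilon> + \<delta>) s"
    and "t = S (2 * (\<epsilon> + \<delta>)) q"
  have q: "q \<in> Q" using qL by (rule L_in)
  have r: "r \<in> Q" unfolding r_def using \<epsilon> q by (rule T.T_in)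
  have s: "s \<in> Q" unfolding s_def using \<epsilon>\<delta> q by (rule S_in_Q)
  have u: "u \<in> Q" unfolding u_def using \<epsilon>\<delta> s by (rule S_in_Q)
  have t: "t \<in> Q" unfolding t_def using \<epsilon>2(2) q by (rule S_in_Q)
  have Tr: "T \<epsilon> r \<in> Q" using \<epsilon> r by (rule T.T_in)
  have Ts: "T \<epsilon> s \<in> Q" using \<epsilon> s by (rule T.T_in)
  have T2: "T (2 * \<epsilon>) q \<in> Q" using \<epsilon>2(1) q by (rule T.T_in)
  have rs: "r \<le> s" unfolding r_def s_def using \<epsilon> q by (rule T_le_S)
  have TrTs: "T \<epsilon> r \<le> T \<epsilon> s" using \<epsilon> r s rs by (rule T.T_mono)
  have Tsu: "T \<epsilon> s \<le> u" unfolding u_def using \<epsilon> s by (rule T_le_S)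
  have ut: "u \<le> t" unfolding u_def s_def t_def using \<epsilon>\<delta> qL by (rule S.T_T_le_double)
  have TrT2: "T \<epsilon> r \<le> T (2 * \<epsilon>) q" unfolding r_def using \<epsilon> q by (rule T.T_T_le_double)
  have qT2: "q \<le> T (2 * \<epsilon>) q" using \<epsilon>2(1) q by (rule T.T_ge)
  have T2t: "T (2 * \<epsilon>) q \<le> t"
  proof -
    have "T (2 * \<epsilon>) q \<le> S (2 * \<epsilon> + \<delta>) q" using \<epsilon>2(1) q by (rule T_le_S)
    also have "\<dots> \<le> t" unfolding t_def using \<epsilon> \<delta> qL by (intro S.T_mono_param) auto
    finally show ?thesis .
  qed
  note le = TrTs Tsu ut TrT2 qT2 T2t
  have h: "\<phi> q \<in> hom (fob M q) (fob N r)" "\<psi> r \<in> hom (fob N r) (fob M (T \<epsilon> r))"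
      "\<psi> s \<in> hom (fob N s) (fob M (T \<epsilon> s))"
    using module_map_hom[OF \<phi> q] module_map_hom[OF \<psi> r] module_map_hom[OF \<psi> s]
    by (simp_all add: r_def)
  note m = h module_hom[OF N r s rs] module_hom[OF M Tr Ts le(1)] module_hom[OF M Ts u le(2)]
    module_hom[OF M u t le(3)] module_hom[OF M Tr T2 le(4)] module_hom[OF M T2 t le(6)]
  have "far M (u, t) \<cdot> (far M (T \<epsilon> s, u) \<cdot> \<psi> s) \<cdot> far N (r, s) \<cdot> \<phi> q =
      (far M (u, t) \<cdot> far M (T \<epsilon> s, u)) \<cdot> (\<psi> s \<cdot> far N (r, s)) \<cdot> \<phi> q"
    using m by (simp add: hom_set_def)
  also have "\<dots> = far M (T \<epsilon> s, t) \<cdot> (far M (T \<epsilon> r, T \<epsilon> s) \<cdot> \<psi> r) \<cdot> \<phi> q"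
    by (simp only: module_comp[OF M Ts u t le(2,3)] module_map_natural[OF \<psi> r s rs] shift_simps)
  also have "\<dots> = (far M (T \<epsilon> s, t) \<cdot> far M (T \<epsilon> r, T \<epsilon> s)) \<cdot> \<psi> r \<cdot> \<phi> q"
    using m module_hom[OF M Ts t order_trans[OF le(2,3)]] by (simp add: hom_set_def)
  also have "far M (T \<epsilon> s, t) \<cdot> far M (T \<epsilon> r, T \<epsilon> s) = far M (T (2 * \<epsilon>) q, t) \<cdot> far M (T \<epsilon> r, T (2 * \<epsilon>) q)"
    by (simp only: module_comp[OF M Tr Ts t le(1) order_trans[OF le(2,3)]] module_comp[OF M Tr T2 t le(4,6)])
  also have "(far M (T (2 * \<epsilon>) q, t) \<cdot> far M (T \<epsilon> r, T (2 * \<epsilon>) q)) \<cdot> \<psi> r \<cdot> \<phi> q =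
      far M (T (2 * \<epsilon>) q, t) \<cdot> far M (T \<epsilon> r, T (2 * \<epsilon>) q) \<cdot> \<psi> r \<cdot> \<phi> q"
    using m by (simp add: hom_set_def)
  also have "far M (T \<epsilon> r, T (2 * \<epsilon>) q) \<cdot> \<psi> r \<cdot> \<phi> q = far M (q, T (2 * \<epsilon>) q)"
    using triangle q unfolding interleaving_triangle_def r_def by (rule bspec)
  also have "far M (T (2 * \<epsilon>) q, t) \<cdot> far M (q, T (2 * \<epsilon>) q) = far M (q, t)"
    by (rule module_comp[OF M q T2 t le(5,6)])
  finally show "far M (S (\<epsilon> + \<delta>) (S (\<epsilon> + \<delta>) q), S (2 * (\<epsilon> + \<delta>)) q) \<cdot>
      restrict_map \<epsilon> M \<psi> (S (\<epsilon> + \<delta>) q) \<cdot> restrict_map \<epsilon> N \<phi> q = far M (q, S (2 * (\<epsilon> + \<delta>)) q)"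
    unfolding restrict_map_def r_def s_def u_def t_def .
qed

lemma extend_map_triangle:
  assumes \<phi>: "is_module_map C L M (shift S \<epsilon> N) \<phi>" and \<psi>: "is_module_map C L N (shift S \<epsilon> M) \<psi>"
    and triangle: "interleaving_triangle C L S \<epsilon> M \<phi> \<psi>"
  shows "interleaving_triangle C Q T (\<epsilon> + \<delta>) M (extend_map \<epsilon> M N \<phi>) (extend_map \<epsilon> N M \<psi>)"
  unfolding interleaving_triangle_def
proof
  fix v assume v: "v \<in> Q"
  have \<epsilon>\<delta>: "\<epsilon> + \<delta> \<ge> 0" and \<epsilon>2: "2 * \<epsilon> \<ge> 0" "2 * (\<epsilon> + \<delta>) \<ge> 0" using \<epsilon> \<delta> by simp_all
  define a b w c where "a = S \<delta> v" and "b = S \<epsilon> a" and "w = T (\<epsilon> + \<delta>) v" and "c = S \<delta> w"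
  define d x y e where "d = S \<epsilon> c" and "x = T (\<epsilon> + \<delta>) w" and "y = T (2 * (\<epsilon> + \<delta>)) v"
    and "e = S (2 * \<epsilon>) a"
  have aL: "a \<in> L" unfolding a_def using \<delta> v by (rule S_in)
  have bL: "b \<in> L" unfolding b_def using \<epsilon> L_in[OF aL] by (rule S_in)
  have w: "w \<in> Q" unfolding w_def using \<epsilon>\<delta> v by (rule T.T_in)
  have cL: "c \<in> L" unfolding c_def using \<delta> w by (rule S_in)
  have dL: "d \<in> L" unfolding d_def using \<epsilon> L_in[OF cL] by (rule S_in)
  have x: "x \<in> Q" unfolding x_def using \<epsilon>\<delta> w by (rule T.T_in)
  have y: "y \<in> Q" unfolding y_def using \<epsilon>2(2) v by (rule T.T_in)
  have eL: "e \<in> L" unfolding e_def using \<epsilon>2(1) L_in[OF aL] by (rule S_in)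
  have SbL: "S \<epsilon> b \<in> L" using \<epsilon> L_in[OF bL] by (rule S_in)
  note Q = L_in[OF aL] L_in[OF bL] L_in[OF cL] L_in[OF dL] L_in[OF eL] L_in[OF SbL]
  have va: "v \<le> a" unfolding a_def using v by (rule le_S_\<delta>)
  have bw: "b \<le> w" unfolding a_def b_def w_def using \<epsilon> v by (rule S_S_le_T)
  have wc: "w \<le> c" unfolding c_def using w by (rule le_S_\<delta>)
  have bc: "b \<le> c" using bw wc by (rule order_trans)
  have Sbd: "S \<epsilon> b \<le> d" unfolding d_def using \<epsilon> bL cL bc by (rule S.T_mono)
  have dx: "d \<le> x" unfolding d_def c_def x_def using \<epsilon> w by (rule S_S_le_T)
  have xy: "x \<le> y" unfolding x_def w_def y_def using \<epsilon>\<delta> v by (rule T.T_T_le_double)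
  have Sbe: "S \<epsilon> b \<le> e" unfolding b_def e_def using \<epsilon> aL by (rule S.T_T_le_double)
  have ae: "a \<le> e" unfolding e_def using \<epsilon>2(1) aL by (rule S.T_ge)
  have ey: "e \<le> y"
  proof -
    have "e \<le> T (2 * \<epsilon> + \<delta>) v" unfolding e_def a_def using \<epsilon>2(1) v by (rule S_S_le_T)
    also have "\<dots> \<le> y" unfolding y_def using \<epsilon> \<delta> v by (intro T.T_mono_param) auto
    finally show ?thesis .
  qed
  have dy: "d \<le> y" using dx xy by (rule order_trans)
  have h: "\<phi> a \<in> hom (fob M a) (fob N b)" "\<psi> b \<in> hom (fob N b) (fob M (S \<epsilon> b))"
      "\<psi> c \<in> hom (fob N c) (fob M d)"
    using module_map_hom[OF \<phi> aL] module_map_hom[OF \<psi> bL] module_map_hom[OF \<psi> cL]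
    by (simp_all add: b_def d_def)
  note m = h module_hom[OF M v Q(1) va] module_hom[OF N Q(2) w bw] module_hom[OF N w Q(3) wc]
    module_hom[OF M Q(4) x dx] module_hom[OF M x y xy] module_hom[OF M Q(4) y dy]
    module_hom[OF M Q(6,4) Sbd] module_hom[OF M Q(6,5) Sbe] module_hom[OF M Q(5) y ey]
    module_hom[OF N Q(2,3) bc]
  have "far M (x, y) \<cdot> (far M (d, x) \<cdot> \<psi> c \<cdot> far N (w, c)) \<cdot> far N (b, w) \<cdot> \<phi> a \<cdot> far M (v, a) =
      (far M (x, y) \<cdot> far M (d, x)) \<cdot> \<psi> c \<cdot> (far N (w, c) \<cdot> far N (b, w)) \<cdot> \<phi> a \<cdot> far M (v, a)"
    using m by (simp add: hom_set_def)
  also have "\<dots> = far M (d, y) \<cdot> \<psi> c \<cdot> far N (b, c) \<cdot> \<phi> a \<cdot> far M (v, a)"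
    by (simp only: module_comp[OF M Q(4) x y dx xy] module_comp[OF N Q(2) w Q(3) bw wc])
  also have "\<dots> = far M (d, y) \<cdot> (\<psi> c \<cdot> far N (b, c)) \<cdot> \<phi> a \<cdot> far M (v, a)"
    using m by (simp add: hom_set_def)
  also have "\<psi> c \<cdot> far N (b, c) = far M (S \<epsilon> b, d) \<cdot> \<psi> b"
    using module_map_natural[OF \<psi> bL cL bc] by (simp add: d_def)
  also have "far M (d, y) \<cdot> (far M (S \<epsilon> b, d) \<cdot> \<psi> b) \<cdot> \<phi> a \<cdot> far M (v, a) =
      (far M (d, y) \<cdot> far M (S \<epsilon> b, d)) \<cdot> \<psi> b \<cdot> \<phi> a \<cdot> far M (v, a)"
    using m by (simp add: hom_set_def)
  also have "far M (d, y) \<cdot> far M (S \<epsilon> b, d) = far M (e, y) \<cdot> far M (S \<epsilon> b, e)"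
    by (simp only: module_comp[OF M Q(6,4) y Sbd dy] module_comp[OF M Q(6,5) y Sbe ey])
  also have "(far M (e, y) \<cdot> far M (S \<epsilon> b, e)) \<cdot> \<psi> b \<cdot> \<phi> a \<cdot> far M (v, a) =
      far M (e, y) \<cdot> (far M (S \<epsilon> b, e) \<cdot> \<psi> b \<cdot> \<phi> a) \<cdot> far M (v, a)"
    using m by (simp add: hom_set_def)
  also have "far M (S \<epsilon> b, e) \<cdot> \<psi> b \<cdot> \<phi> a = far M (a, e)"
    using triangle aL unfolding interleaving_triangle_def b_def e_def by (rule bspec)
  also have "far M (a, e) \<cdot> far M (v, a) = far M (v, e)"
    by (rule module_comp[OF M v Q(1,5) va ae])
  also have "far M (e, y) \<cdot> far M (v, e) = far M (v, y)"
    by (rule module_comp[OF M v Q(5) y order_trans[OF va ae] ey])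
  finally show "far M (T (\<epsilon> + \<delta>) (T (\<epsilon> + \<delta>) v), T (2 * (\<epsilon> + \<delta>)) v) \<cdot>
      extend_map \<epsilon> N M \<psi> (T (\<epsilon> + \<delta>) v) \<cdot> extend_map \<epsilon> M N \<phi> v = far M (v, T (2 * (\<epsilon> + \<delta>)) v)"
    unfolding extend_map_def a_def b_def w_def c_def d_def x_def y_def .
qed

end

text \<open>Each transfer composes the interleaving maps with internal maps, and the parameter grows by the one
  \<open>\<delta>\<close> that separates \<open>T\<close> from \<open>S\<close>.\<close>

theorem weak_dist_approximation:
  assumes M: "is_module C Q M" and N: "is_module C Q N"
  shows "weak_dist C L S M N \<le> weak_dist C Q T M N + ennreal \<delta>"
    and "weak_dist C Q T M N \<le> weak_dist C L S M N + ennreal \<delta>"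
proof -
  note M_L = is_module_subset[OF M L_subset] and N_L = is_module_subset[OF N L_subset]
  show "weak_dist C L S M N \<le> weak_dist C Q T M N + ennreal \<delta>"
  proof (rule weak_dist_le_add[OF \<delta>])
    fix \<epsilon> :: real and \<phi> \<psi> assume \<epsilon>: "\<epsilon> \<ge> 0" and int: "weak_interleaving C Q T \<epsilon> M N \<phi> \<psi>"
    have \<epsilon>\<delta>: "\<epsilon> + \<delta> \<ge> 0" using \<epsilon> \<delta> by simp
    have "weak_interleaving C L S (\<epsilon> + \<delta>) M N (restrict_map \<epsilon> N \<phi>) (restrict_map \<epsilon> M \<psi>)"
      using int unfolding T.weak_interleaving_iff[OF M N \<epsilon>] S.weak_interleaving_iff[OF M_L N_L \<epsilon>\<delta>]
      by (elim conjE) (intro conjI restrict_map_natural restrict_map_triangle M N \<epsilon>; assumption)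
    then show "\<exists>\<phi>' \<psi>'. weak_interleaving C L S (\<epsilon> + \<delta>) M N \<phi>' \<psi>'" by (intro exI)
  qed
  show "weak_dist C Q T M N \<le> weak_dist C L S M N + ennreal \<delta>"
  proof (rule weak_dist_le_add[OF \<delta>])
    fix \<epsilon> :: real and \<phi> \<psi> assume \<epsilon>: "\<epsilon> \<ge> 0" and int: "weak_interleaving C L S \<epsilon> M N \<phi> \<psi>"
    have \<epsilon>\<delta>: "\<epsilon> + \<delta> \<ge> 0" using \<epsilon> \<delta> by simp
    have "weak_interleaving C Q T (\<epsilon> + \<delta>) M N (extend_map \<epsilon> M N \<phi>) (extend_map \<epsilon> N M \<psi>)"
      using int unfolding T.weak_interleaving_iff[OF M N \<epsilon>\<delta>] S.weak_interleaving_iff[OF M_L N_L \<epsilon>]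
      by (elim conjE) (intro conjI extend_map_natural extend_map_triangle M N \<epsilon>; assumption)
    then show "\<exists>\<phi>' \<psi>'. weak_interleaving C Q T (\<epsilon> + \<delta>) M N \<phi>' \<psi>'" by (intro exI)
  qed
qed

end

section \<open>Covers and cosheaves\<close>

lemma meet_completion_subset_opens: "meet_completion X \<Lambda> U \<subseteq> opens X"
  unfolding meet_completion_def opens_def by auto

lemma meet_completion_Int:
  assumes "V \<in> meet_completion X \<Lambda> U" "W \<in> meet_completion X \<Lambda> U"
  shows "V \<inter> W \<in> meet_completion X \<Lambda> U"
proof -
  obtain \<sigma> \<tau> where V: "V = X interior_of (topspace X \<inter> (\<Inter>k\<in>\<sigma>. U k))" "\<sigma> \<subseteq> \<Lambda>"
    and W: "W = X interior_of (topspace X \<inter> (\<Inter>k\<in>\<tau>. U k))" "\<tau> \<subseteq> \<Lambda>"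
    using assms unfolding meet_completion_def by blast
  have "(topspace X \<inter> (\<Inter>k\<in>\<sigma>. U k)) \<inter> (topspace X \<inter> (\<Inter>k\<in>\<tau>. U k)) =
      topspace X \<inter> (\<Inter>k\<in>\<sigma> \<union> \<tau>. U k)" by auto
  then have "V \<inter> W = X interior_of (topspace X \<inter> (\<Inter>k\<in>\<sigma> \<union> \<tau>. U k))"
    by (simp only: V(1) W(1) interior_of_Int[symmetric])
  moreover have "\<sigma> \<union> \<tau> \<subseteq> \<Lambda>" using V(2) W(2) by simp
  ultimately show ?thesis
    unfolding meet_completion_def by (intro CollectI exI[of _ "\<sigma> \<union> \<tau>"] conjI)
qed

lemma meet_completion_Inter:
  assumes "finite \<F>" "\<F> \<noteq> {}" "\<F> \<subseteq> meet_completion X \<Lambda> U"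
  shows "\<Inter>\<F> \<in> meet_completion X \<Lambda> U"
  using assms by (induction rule: finite_ne_induct) (simp_all add: meet_completion_Int)

lemma lattice_completion_iff:
  "V \<in> lattice_completion X \<Lambda> U \<longleftrightarrow> \<Union>{W \<in> meet_completion X \<Lambda> U. W \<subseteq> V} = V"
proof
  assume "V \<in> lattice_completion X \<Lambda> U"
  then obtain \<S> where "V = \<Union>\<S>" "\<S> \<subseteq> meet_completion X \<Lambda> U"
    unfolding lattice_completion_def by blast
  then show "\<Union>{W \<in> meet_completion X \<Lambda> U. W \<subseteq> V} = V" by auto
next
  assume "\<Union>{W \<in> meet_completion X \<Lambda> U. W \<subseteq> V} = V"
  then show "V \<in> lattice_completion X \<Lambda> U"
    unfolding lattice_completion_def
    by (intro CollectI exI[of _ "{W \<in> meet_completion X \<Lambda> U. W \<subseteq> V}"] conjI) auto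
qed

lemma lattice_completion_Union:
  assumes "\<W> \<subseteq> lattice_completion X \<Lambda> U"
  shows "\<Union>\<W> \<in> lattice_completion X \<Lambda> U"
  unfolding lattice_completion_iff
proof
  show "\<Union>{W \<in> meet_completion X \<Lambda> U. W \<subseteq> \<Union>\<W>} \<subseteq> \<Union>\<W>" by blast
  show "\<Union>\<W> \<subseteq> \<Union>{W \<in> meet_completion X \<Lambda> U. W \<subseteq> \<Union>\<W>}"
  proof (rule Union_least)
    fix V assume V: "V \<in> \<W>"
    then have "V = \<Union>{W \<in> meet_completion X \<Lambda> U. W \<subseteq> V}"
      using assms lattice_completion_iff[of V X \<Lambda> U] by auto
    also have "\<dots> \<subseteq> \<Union>{W \<in> meet_completion X \<Lambda> U. W \<subseteq> \<Union>\<W>}"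
      by (rule Union_mono) (use V in blast)
    finally show "V \<subseteq> \<Union>{W \<in> meet_completion X \<Lambda> U. W \<subseteq> \<Union>\<W>}" .
  qed
qed

lemma meet_subset_lattice_completion: "meet_completion X \<Lambda> U \<subseteq> lattice_completion X \<Lambda> U"
  unfolding lattice_completion_iff subset_eq by auto

lemma lattice_completion_subset_opens: "lattice_completion X \<Lambda> U \<subseteq> opens X"
proof
  fix V assume "V \<in> lattice_completion X \<Lambda> U"
  then obtain \<S> where "\<S> \<subseteq> meet_completion X \<Lambda> U" "V = \<Union>\<S>"
    unfolding lattice_completion_def by blast
  moreover have "openin X W" if "W \<in> meet_completion X \<Lambda> U" for W
    using meet_completion_subset_opens that unfolding opens_def by blast
  ultimately show "V \<in> opens X" unfolding opens_def by (auto intro: openin_Union)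
qed

text \<open>The members of the meet completion inside a member \<open>V\<close> of the lattice completion cover \<open>V\<close> and are
  closed under finite intersections, so the cosheaf condition applies to them. The colimit over this
  cover is the pushforward along the inclusion, and the map to \<open>F(V)\<close> is the counit.\<close>

lemma cosheaf_counit_iso:
  assumes F: "cosheaf C X F" and V: "V \<in> lattice_completion X \<Lambda> U"
  shows "is_iso C (adj_counit C (meet_completion X \<Lambda> U) id F V)"
proof -
  let ?\<V> = "{W \<in> meet_completion X \<Lambda> U. W \<subseteq> V}"
  have "cech_cover X V ?\<V>"
    unfolding cech_cover_def
  proof (intro conjI allI impI)
    show "?\<V> \<subseteq> opens X" using meet_completion_subset_opens by blast
    show "\<Union>?\<V> = V" using V by (simp only: lattice_completion_iff)
    fix \<F> assume \<F>: "\<F> \<subseteq> ?\<V>" "finite \<F>" "\<F> \<noteq> {}"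
    have "\<Inter>\<F> \<in> meet_completion X \<Lambda> U" using \<F> by (intro meet_completion_Inter) auto
    moreover have "\<Inter>\<F> \<subseteq> V" using \<F> by blast
    ultimately show "\<Inter>\<F> \<in> ?\<V>" by simp
  qed
  moreover have "V \<in> opens X" using V lattice_completion_subset_opens by blast
  ultimately have "is_iso C (colim_desc C (poset_cat ?\<V>) F (fob F V) (\<lambda>W. far F (W, V)))"
    using F unfolding cosheaf_def by blast
  then show ?thesis by (simp add: adj_counit_def below_def)
qed

context
  fixes X :: "'a topology" and T :: "real \<Rightarrow> 'a set \<Rightarrow> 'a set" and L :: "'a set set"
  assumes T: "superlinear_family (opens X) T"
    and L_opens: "L \<subseteq> opens X" and L_Union: "\<And>\<W>. \<W> \<subseteq> L \<Longrightarrow> \<Union>\<W> \<in> L"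
begin

interpretation superlinear "opens X" T
  by unfold_locales (rule T)

lemma lower_translation_in: "lower_translation L T \<epsilon> V \<in> L"
  unfolding lower_translation_def lower_approx_def by (rule L_Union) blast

lemma lower_translation_subset: "lower_translation L T \<epsilon> V \<subseteq> T \<epsilon> V"
  unfolding lower_translation_def lower_approx_def by blast

lemma lower_translation_greatest: "W \<in> L \<Longrightarrow> W \<subseteq> T \<epsilon> V \<Longrightarrow> W \<subseteq> lower_translation L T \<epsilon> V"
  unfolding lower_translation_def lower_approx_def by blast

lemma lower_translation_mono_on:
  assumes "\<epsilon> \<ge> 0"
  shows "mono_on (opens X) (lower_translation L T \<epsilon>)"
proof (rule mono_onI)
  fix V W assume "V \<in> opens X" "W \<in> opens X" "V \<le> W"
  then have "T \<epsilon> V \<subseteq> T \<epsilon> W" using assms by (intro T_mono)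
  then show "lower_translation L T \<epsilon> V \<subseteq> lower_translation L T \<epsilon> W"
    unfolding lower_translation_def lower_approx_def by blast
qed

text \<open>Superlinearity survives lower approximation: an iterate of the approximations lies in \<open>L\<close> and in the
  iterate of \<open>T\<close>, hence below the largest member of \<open>L\<close> inside the translate by the sum.\<close>

lemma superlinear_lower_translation: "superlinear_family L (lower_translation L T)"
  unfolding superlinear_family_def translation_def
proof (intro conjI allI impI ballI)
  fix \<epsilon> :: real assume \<epsilon>: "\<epsilon> \<ge> 0"
  show "lower_translation L T \<epsilon> ` L \<subseteq> L" using lower_translation_in by blast
  show "mono_on L (lower_translation L T \<epsilon>)"
    using lower_translation_mono_on[OF \<epsilon>] L_opens by (rule mono_on_subset)
  show "V \<le> lower_translation L T \<epsilon> V" if V: "V \<in> L" for V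
  proof -
    have "V \<in> opens X" using V L_opens by blast
    then show ?thesis using V T_ge[OF \<epsilon>] by (intro lower_translation_greatest)
  qed
next
  fix \<epsilon>\<^sub>1 \<epsilon>\<^sub>2 :: real and V assume \<epsilon>: "\<epsilon>\<^sub>1 \<ge> 0" "\<epsilon>\<^sub>2 \<ge> 0" and V: "V \<in> L"
  have Vo: "V \<in> opens X" using V L_opens by blast
  define W where "W = lower_translation L T \<epsilon>\<^sub>1 V"
  have W: "W \<in> opens X" using lower_translation_in L_opens unfolding W_def by blast
  have "lower_translation L T \<epsilon>\<^sub>2 W \<subseteq> T \<epsilon>\<^sub>2 W" by (rule lower_translation_subset)
  also have "\<dots> \<subseteq> T \<epsilon>\<^sub>2 (T \<epsilon>\<^sub>1 V)"
    using \<epsilon> W T_in[OF \<epsilon>(1) Vo] lower_translation_subset unfolding W_def by (intro T_mono)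
  also have "\<dots> \<subseteq> T (\<epsilon>\<^sub>1 + \<epsilon>\<^sub>2) V" using \<epsilon> Vo by (rule T_T_le)
  finally show "lower_translation L T \<epsilon>\<^sub>2 (lower_translation L T \<epsilon>\<^sub>1 V) \<le> lower_translation L T (\<epsilon>\<^sub>1 + \<epsilon>\<^sub>2) V"
    unfolding W_def by (intro lower_translation_greatest lower_translation_in)
qed

text \<open>Density applied to \<open>T \<epsilon> V\<close> gives a member of \<open>L\<close> between \<open>T \<epsilon> V\<close> and \<open>T (\<epsilon> + \<delta>) V\<close>.\<close>

lemma approximation_lower_translation:
  assumes C: "is_category C" and \<delta>: "\<delta> \<ge> 0"
    and dense: "\<And>V. V \<in> opens X \<Longrightarrow> \<exists>W\<in>L. V \<subseteq> W \<and> W \<subseteq> T \<delta> V"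
  shows "approximation C (opens X) T L (lower_translation L T) \<delta>"
proof unfold_locales
  fix \<epsilon> :: real and V assume \<epsilon>: "\<epsilon> \<ge> 0" and V: "V \<in> opens X"
  obtain W where W: "W \<in> L" "T \<epsilon> V \<subseteq> W" "W \<subseteq> T \<delta> (T \<epsilon> V)" using dense[OF T_in[OF \<epsilon> V]] by blast
  have "W \<subseteq> T (\<epsilon> + \<delta>) V" using W(3) T_T_le[OF \<epsilon> \<delta> V] by (rule order_trans)
  then show "T \<epsilon> V \<le> lower_translation L T (\<epsilon> + \<delta>) V"
    using lower_translation_greatest[OF W(1)] W(2) by blast
qed (use C \<delta> L_opens lower_translation_in in
    \<open>auto intro: superlinear_lower_translation lower_translation_mono_on lower_translation_subset[THEN subsetD]\<close>)

end

section \<open>The stability theorem\<close>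

theorem theorem6p6:
  fixes C :: "('o, 'm) cat"
    and X :: "'a topology"
    and \<Lambda> :: "'k set" and U :: "'k \<Rightarrow> 'a set"
    and T :: "real \<Rightarrow> 'a set \<Rightarrow> 'a set" and \<delta> :: real
    and M N :: "('a set, 'o, 'm) pmodule"
  assumes "is_category C"
    and "cocomplete TYPE(('a set, 'a set \<times> 'a set) cat) C"
    and "open_cover X \<Lambda> U"
    and "superlinear_family (opens X) T"
    and "\<delta> > 0"
    and "\<forall>V\<in>opens X. \<exists>W\<in>lattice_completion X \<Lambda> U. V \<subseteq> W \<and> W \<subseteq> T \<delta> V"
    and "cosheaf C X M" and "cosheaf C X N"
  shows "let MU = meet_completion X \<Lambda> U; LU = lattice_completion X \<Lambda> U;
             i = id; f = id; j = id;
             T_low = lower_translation LU T;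
             d = weak_dist C (opens X) T M N;
             d_L = weak_dist C LU T_low (pullback f M) (pullback f N);
             d_M = weak_rel_dist C MU j T_low (pullback i M) (pullback i N)
         in d_M = d_L \<and> d_L \<le> d + ennreal (2 * \<delta>) \<and> d \<le> d_L + ennreal (2 * \<delta>)"
proof -
  define MU where "MU = meet_completion X \<Lambda> U"
  define L where "L = lattice_completion X \<Lambda> U"
  define S where "S = lower_translation L T"
  have L: "L \<subseteq> opens X" "\<And>\<W>. \<W> \<subseteq> L \<Longrightarrow> \<Union>\<W> \<in> L"
    unfolding L_def by (fact lattice_completion_subset_opens, fact lattice_completion_Union)
  have mods: "is_module C (opens X) M" "is_module C (opens X) N"
    using assms(7,8) by (simp_all only: cosheaf_def)
  interpret relative_setting C MU id L S
  proof unfold_locales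
    show "id ` MU \<subseteq> L" unfolding MU_def L_def using meet_subset_lattice_completion by simp
    show "superlinear_family L S" unfolding S_def by (rule superlinear_lower_translation[OF assms(4) L])
  qed (use assms(1,2) in \<open>simp_all add: mono_on_def\<close>)
  have rel: "weak_rel_dist C MU id S (pullback id M) (pullback id N) = weak_dist C L S M N"
    using is_module_subset[OF mods(1) L(1)] is_module_subset[OF mods(2) L(1)]
    by (rule weak_rel_dist_pullback) (simp_all only: MU_def L_def cosheaf_counit_iso assms(7,8))
  interpret approximation C "opens X" T L S \<delta>
    unfolding S_def using assms(5,6)
    by (intro approximation_lower_translation assms(1,4) L) (auto simp: L_def)
  \<comment> \<open>The approximation costs \<open>\<delta>\<close> in each direction, which is weakened to \<open>2 * \<delta>\<close>.\<close>
  have "ennreal \<delta> \<le> ennreal (2 * \<delta>)" using assms(5) by (simp add: ennreal_leI)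
  then have "x + ennreal \<delta> \<le> x + ennreal (2 * \<delta>)" for x by (rule add_left_mono)
  then have "weak_dist C L S M N \<le> weak_dist C (opens X) T M N + ennreal (2 * \<delta>)"
      "weak_dist C (opens X) T M N \<le> weak_dist C L S M N + ennreal (2 * \<delta>)"
    using weak_dist_approximation[OF mods] order_trans by blast+
  with rel show ?thesis
    unfolding Let_def pullback_id MU_def L_def S_def by simp
qed

end
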